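(* Let $k\ge1$ and $\Lambda\in P^+_{cl,k}$. The inverse map $\phi^{-1}_{\Lambda}:P^+_{cl,k}(\Lambda) \rightarrow \max^+(\Lambda)$ of the bijection $\phi_\Lambda$ is given by $$\phi^{-1}_{\Lambda}(\Lambda')= \Lambda-\sum_{i\in I}x_i \alpha_i,$$ where $X=(x_0,x_1,\ldots,x_\ell)$ is the unique vector in $\mathbb Z_{\ge0}^{\ell+1}$ with $\min_i x_i=0$ and $AX^t=Y_{\Lambda'}^t$, $Y_{\Lambda'}=(\langle h_i,\Lambda-\Lambda'\rangle)_{i\in I}$.
   Context: Fix an integer $\ell\ge1$, $e=\ell+1$, $I=\{0,1,\dots,\ell\}$, $I_0=I\setminus\{0\}$. $A=(a_{ij})_{i,j\in I}$ is the affine Cartan matrix of type $A^{(1)}_\ell$: $a_{ii}=2$; if $\ell=1$, $a_{01}=a_{10}=-2$; if $\ell\ge2$ and $i\ne j$, $a_{ij}=-1$ when $i-j\equiv\pm1 \pmod e$ and $0$ otherwise. $P=\bigoplus_{i\in I}\mathbb Z\Lambda_i\oplus\mathbb Z\delta$, with simple roots $\alpha_i$ and simple coroots $h_i\in\mathrm{Hom}(P,\mathbb Z)$, $\langle h_i,\alpha_j\rangle=a_{ij}$, $\langle h_i,\Lambda_j\rangle=\delta_{ij}$, $\delta=\sum_i\alpha_i$, $\langle h_i,\delta\rangle=0$. $P^+=\{\mu\in P\mid\langle h_i,\mu\rangle\ge0\ \forall i\in I\}$, and $P^+_{cl,k}=\{\sum_{i\in I}m_i\Lambda_i\mid m_i\in\mathbb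 Z_{\ge0},\ \sum_i m_i=k\}$. $V(\Lambda)$ is the integrable highest weight module of highest weight $\Lambda$ over the (quantum group of the) affine Kac–Moody algebra of type $A^{(1)}_\ell$, $P(\Lambda)\subset P$ its set of weights, $\max(\Lambda)=\{\mu\in P(\Lambda)\mid\mu+\delta\notin P(\Lambda)\}$, and $\max^+(\Lambda)=\max(\Lambda)\cap P^+$ the set of dominant maximal weights. $P^+_{cl,k}(\Lambda)$ is the sieving equivalence class of $\Lambda$, i.e. $\{\Lambda'\in P^+_{cl,k}\mid\mathrm{ev}(\Lambda')\equiv\mathrm{ev}(\Lambda)\pmod e\}$ with $\mathrm{ev}(\sum m_i\Lambda_i)=\sum_{i\in I_0}i\,m_i$. The map $\phi_\Lambda$: let $(\cdot,\cdot)$ be the nondegenerate symmetric bilinear form on $\mathbb R\otimes_{\mathbb Z}P$ with $(\alpha_i,\alpha_j)=a_{ij}$, $(\alpha_i,\Lambda_0)=\delta_{i0}$, $(\delta,\Lambda_0)=1$, $(\delta,\delta)=(\Lambda_0,\Lambda_0)=0$, and let $\bar\mu=\mu-(\delta,\mu)\Lambda_0-(\Lambda_0,\mu)\delta$ be the orthogonal projection (so $\bar\delta=\bar\Lambda_0=0$ and $\{\bar\Lambda_i\}_{i\in I_0}$ is a basis of the image). For $\mu\in\max^+(\Lambda)$ with $\bar\mu=\sum_{i\in I_0}m_i\bar\Lambda_i$ put $\phi_\Lambda(\mu)=m_0\Lambda_0+\sum_{i\in I_0}m_i\Lambda_i$ with $m_0=k-\sum_{i\in I_0}m_i$. It is known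 (Kac; Kim–Oh–Oh) that $\phi_\Lambda:\max^+(\Lambda)\to P^+_{cl,k}(\Lambda)$ is a bijection. *)

theory Defs
  imports
    "HOL-Library.Poly_Mapping"
    "HOL-Number_Theory.Cong"
    "Jordan_Normal_Form.Matrix"
begin

section \<open>Cartan matrix and weight lattice of type \<open>A\<^sup>(\<^sup>1\<^sup>)\<close> of rank \<open>l\<close>\<close>

definition acoef :: "nat \<Rightarrow> nat \<Rightarrow> nat \<Rightarrow> int" where
  "acoef l i j =
    (if i = j then 2
     else if l = 1 then -2
     else if [int i - int j = 1] (mod int (l + 1)) \<or> [int i - int j = -1] (mod int (l + 1)) then -1
     else 0)"

definition cartan :: "nat \<Rightarrow> int mat" where
  "cartan l = mat (l + 1) (l + 1) (\<lambda>(i, j). acoef l i j)"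

text \<open>
  The weight lattice \<open>P\<close> is the free abelian group on the fundamental weights
  \<open>\<Lambda>\<^sub>i\<close> (\<open>i \<le> l\<close>) and the null root \<open>\<delta>\<close>.  Since the
  type does not know \<open>l\<close>, the restriction \<open>i \<le> l\<close> is imposed by
  \<open>weight_lattice l\<close>.
\<close>

datatype wt_basis = Fund nat | Null

type_synonym weight = "wt_basis \<Rightarrow>\<^sub>0 int"

definition basis :: "nat \<Rightarrow> wt_basis set" where
  "basis l = insert Null (Fund ` {..l})"

definition weight_lattice :: "nat \<Rightarrow> weight set" where
  "weight_lattice l = {\<mu>. Poly_Mapping.keys \<mu> \<subseteq> basis l}"

definition fund_weight :: "nat \<Rightarrow> weight" where
  "fund_weight i = frag_of (Fund i)"

definition null_root :: weight where
  "null_root = frag_of Null"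

text \<open>
  \<open>coroot i\<close> is \<open>\<mu> \<mapsto> \<langle>h\<^sub>i, \<mu>\<rangle>\<close>.
  Together with \<open>scaling\<close>, the functional \<open>d\<close> given by
  \<open>\<langle>d, \<Lambda>\<^sub>i\<rangle> = 0\<close> and \<open>\<langle>d, \<delta>\<rangle> = 1\<close>, the coroots form
  the basis of \<open>Hom(P, \<int>)\<close> dual to the chosen basis of \<open>P\<close>.
\<close>

definition coroot :: "nat \<Rightarrow> weight \<Rightarrow> int" where
  "coroot i \<mu> = Poly_Mapping.lookup \<mu> (Fund i)"

definition scaling :: "weight \<Rightarrow> int" where
  "scaling \<mu> = Poly_Mapping.lookup \<mu> Null"

text \<open>
  The coefficients of \<open>\<Lambda>\<^sub>j\<close> are forced by \<open>\<langle>h\<^sub>j, \<alpha>\<^sub>i\<rangle> = a\<^sub>j\<^sub>i\<close>;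
  those of \<open>\<delta>\<close> by the requirements \<open>(\<alpha>\<^sub>i, \<Lambda>\<^sub>0) = \<delta>\<^sub>i\<^sub>0\<close> and
  \<open>(\<Lambda>\<^sub>0, \<Lambda>\<^sub>j) = 0\<close> on the form below (\<open>\<Lambda>\<^sub>j\<close> being normalised without
  \<open>\<delta>\<close>-part).
\<close>

definition simple_root :: "nat \<Rightarrow> nat \<Rightarrow> weight" where
  "simple_root l i =
     (\<Sum>j\<le>l. frag_cmul (acoef l j i) (fund_weight j)) + (if i = 0 then null_root else 0)"

definition dominant :: "nat \<Rightarrow> weight set" where
  "dominant l = {\<mu> \<in> weight_lattice l. \<forall>i\<le>l. 0 \<le> coroot i \<mu>}"

definition P_cl :: "nat \<Rightarrow> nat \<Rightarrow> weight set" where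
  "P_cl l k = {\<Sum>i\<le>l. frag_cmul (int (m i)) (fund_weight i) | m :: nat \<Rightarrow> nat. (\<Sum>i\<le>l. m i) = k}"

definition ev :: "nat \<Rightarrow> weight \<Rightarrow> int" where
  "ev l \<mu> = (\<Sum>i=1..l. int i * coroot i \<mu>)"

definition sieve_class :: "nat \<Rightarrow> nat \<Rightarrow> weight \<Rightarrow> weight set" where
  "sieve_class l k \<Lambda> = {\<Lambda>' \<in> P_cl l k. [ev l \<Lambda>' = ev l \<Lambda>] (mod int (l + 1))}"

section \<open>The invariant form and the map \<open>\<phi>\<close>\<close>

type_synonym rweight = "wt_basis \<Rightarrow>\<^sub>0 real"

definition of_weight :: "weight \<Rightarrow> rweight" where
  "of_weight \<mu> = Poly_Mapping.map real_of_int \<mu>"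

definition rcmul :: "real \<Rightarrow> rweight \<Rightarrow> rweight" where
  "rcmul c v = Poly_Mapping.map ((*) c) v"

definition real_span :: "nat \<Rightarrow> rweight set" where
  "real_span l = {v. Poly_Mapping.keys v \<subseteq> basis l}"

text \<open>
  Gram matrix, in the basis \<open>\<Lambda>\<^sub>0, \<dots>, \<Lambda>\<^sub>l, \<delta>\<close>, of the form characterised by
  \<open>(\<alpha>\<^sub>i, \<alpha>\<^sub>j) = a\<^sub>i\<^sub>j\<close>, \<open>(\<alpha>\<^sub>i, \<Lambda>\<^sub>0) = \<delta>\<^sub>i\<^sub>0\<close>, \<open>(\<delta>, \<Lambda>\<^sub>0) = 1\<close> and
  \<open>(\<delta>, \<delta>) = (\<Lambda>\<^sub>0, \<Lambda>\<^sub>0) = 0\<close>; these properties are proved below.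
  Its block on \<open>\<Lambda>\<^sub>1, \<dots>, \<Lambda>\<^sub>l\<close> is the inverse Cartan matrix of the finite type.
\<close>

fun gram :: "nat \<Rightarrow> wt_basis \<Rightarrow> wt_basis \<Rightarrow> real" where
  "gram l (Fund i) (Fund j) = real (min i j) - real i * real j / real (l + 1)"
| "gram l (Fund i) Null = 1"
| "gram l Null (Fund j) = 1"
| "gram l Null Null = 0"

definition form :: "nat \<Rightarrow> rweight \<Rightarrow> rweight \<Rightarrow> real" where
  "form l v w = (\<Sum>a\<in>basis l. \<Sum>b\<in>basis l.
     Poly_Mapping.lookup v a * Poly_Mapping.lookup w b * gram l a b)"

definition bar :: "nat \<Rightarrow> weight \<Rightarrow> rweight" where
  "bar l \<mu> = of_weight \<mu>
     - rcmul (form l (of_weight null_root) (of_weight \<mu>)) (of_weight (fund_weight 0))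
     - rcmul (form l (of_weight (fund_weight 0)) (of_weight \<mu>)) (of_weight null_root)"

text \<open>
  The \<open>m\<^sub>i\<close> are the coordinates of the projection of \<open>\<mu>\<close> in the basis
  \<open>bar \<Lambda>\<^sub>i\<close> (\<open>1 \<le> i \<le> l\<close>).
\<close>

definition phi :: "nat \<Rightarrow> nat \<Rightarrow> weight \<Rightarrow> weight" where
  "phi l k \<mu> = (THE \<nu>. \<exists>m :: nat \<Rightarrow> int.
      bar l \<mu> = (\<Sum>i=1..l. rcmul (real_of_int (m i)) (bar l (fund_weight i))) \<and>
      \<nu> = frag_cmul (int k - (\<Sum>i=1..l. m i)) (fund_weight 0)
            + (\<Sum>i=1..l. frag_cmul (m i) (fund_weight i)))"

section \<open>Integrable highest weight modules of the affine Kac--Moody algebra\<close>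

text \<open>
  The affine Kac--Moody algebra \<open>g\<close> over \<open>\<complex>\<close> is presented by the Chevalley generators
  \<open>e\<^sub>i\<close>, \<open>f\<^sub>i\<close>, \<open>h\<^sub>i\<close> (\<open>i \<le> l\<close>) and \<open>d\<close> with the Serre relations, so a \<open>g\<close>-module is
  a complex vector space with linear operators satisfying these relations.
  The underlying space is the whole type.
\<close>

record 'v chevalley =
  smult :: "complex \<Rightarrow> 'v \<Rightarrow> 'v"
  E :: "nat \<Rightarrow> 'v \<Rightarrow> 'v"
  F :: "nat \<Rightarrow> 'v \<Rightarrow> 'v"
  H :: "nat \<Rightarrow> 'v \<Rightarrow> 'v"
  D :: "'v \<Rightarrow> 'v"

definition comm :: "('v::ab_group_add \<Rightarrow> 'v) \<Rightarrow> ('v \<Rightarrow> 'v) \<Rightarrow> 'v \<Rightarrow> 'v" where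
  "comm x y = (\<lambda>v. x (y v) - y (x v))"

definition affine_module :: "nat \<Rightarrow> 'v::ab_group_add chevalley \<Rightarrow> bool" where
  "affine_module l V \<longleftrightarrow>
     vector_space (smult V) \<and>
     (\<forall>i\<le>l. Vector_Spaces.linear (smult V) (smult V) (E V i) \<and>
            Vector_Spaces.linear (smult V) (smult V) (F V i) \<and>
            Vector_Spaces.linear (smult V) (smult V) (H V i)) \<and>
     Vector_Spaces.linear (smult V) (smult V) (D V) \<and>
     (\<forall>i\<le>l. \<forall>j\<le>l. comm (H V i) (H V j) = (\<lambda>v. 0)) \<and>
     (\<forall>i\<le>l. comm (D V) (H V i) = (\<lambda>v. 0)) \<and>
     (\<forall>i\<le>l. \<forall>j\<le>l.
        comm (H V i) (E V j) = (\<lambda>v. smult V (of_int (coroot i (simple_root l j))) (E V j v)) \<and>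
        comm (H V i) (F V j) = (\<lambda>v. smult V (- of_int (coroot i (simple_root l j))) (F V j v))) \<and>
     (\<forall>j\<le>l.
        comm (D V) (E V j) = (\<lambda>v. smult V (of_int (scaling (simple_root l j))) (E V j v)) \<and>
        comm (D V) (F V j) = (\<lambda>v. smult V (- of_int (scaling (simple_root l j))) (F V j v))) \<and>
     (\<forall>i\<le>l. \<forall>j\<le>l. comm (E V i) (F V j) = (if i = j then H V i else (\<lambda>v. 0))) \<and>
     (\<forall>i\<le>l. \<forall>j\<le>l. i \<noteq> j \<longrightarrow>
        (comm (E V i) ^^ nat (1 - acoef l i j)) (E V j) = (\<lambda>v. 0) \<and>
        (comm (F V i) ^^ nat (1 - acoef l i j)) (F V j) = (\<lambda>v. 0))"

definition weight_space :: "nat \<Rightarrow> 'v::ab_group_add chevalley \<Rightarrow> weight \<Rightarrow> 'v set" where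
  "weight_space l V \<mu> =
     {v. (\<forall>i\<le>l. H V i v = smult V (of_int (coroot i \<mu>)) v) \<and>
         D V v = smult V (of_int (scaling \<mu>)) v}"

text \<open>
  Integrable: the direct sum of its weight spaces (distinct ones are always independent, so
  spanning suffices), with all \<open>e\<^sub>i\<close> and \<open>f\<^sub>i\<close> acting locally nilpotently.
\<close>

definition integrable :: "nat \<Rightarrow> 'v::ab_group_add chevalley \<Rightarrow> bool" where
  "integrable l V \<longleftrightarrow>
     module.span (smult V) (\<Union>\<mu>\<in>weight_lattice l. weight_space l V \<mu>) = UNIV \<and>
     (\<forall>i\<le>l. \<forall>v. \<exists>n. (E V i ^^ n) v = 0) \<and>
     (\<forall>i\<le>l. \<forall>v. \<exists>n. (F V i ^^ n) v = 0)"

definition submodule :: "nat \<Rightarrow> 'v::ab_group_add chevalley \<Rightarrow> 'v set \<Rightarrow> bool" where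
  "submodule l V W \<longleftrightarrow>
     module.subspace (smult V) W \<and>
     (\<forall>w\<in>W. (\<forall>i\<le>l. E V i w \<in> W \<and> F V i w \<in> W \<and> H V i w \<in> W) \<and> D V w \<in> W)"

definition highest_weight_module :: "nat \<Rightarrow> 'v::ab_group_add chevalley \<Rightarrow> weight \<Rightarrow> bool" where
  "highest_weight_module l V \<Lambda> \<longleftrightarrow>
     affine_module l V \<and>
     (\<exists>v. v \<noteq> 0 \<and> v \<in> weight_space l V \<Lambda> \<and> (\<forall>i\<le>l. E V i v = 0) \<and>
          (\<forall>W. submodule l V W \<and> v \<in> W \<longrightarrow> W = UNIV))"

text \<open>
  For dominant integral \<open>\<Lambda>\<close> a module \<open>V\<close> satisfying this is unique up to isomorphism;
  it is \<open>V(\<Lambda>)\<close>.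
\<close>

definition integrable_highest_weight_module ::
    "nat \<Rightarrow> 'v::ab_group_add chevalley \<Rightarrow> weight \<Rightarrow> bool" where
  "integrable_highest_weight_module l V \<Lambda> \<longleftrightarrow>
     highest_weight_module l V \<Lambda> \<and> integrable l V"

definition weights :: "nat \<Rightarrow> 'v::ab_group_add chevalley \<Rightarrow> weight set" where
  "weights l V = {\<mu> \<in> weight_lattice l. \<exists>v \<in> weight_space l V \<mu>. v \<noteq> 0}"

definition max_weights :: "nat \<Rightarrow> 'v::ab_group_add chevalley \<Rightarrow> weight set" where
  "max_weights l V = {\<mu> \<in> weights l V. \<mu> + null_root \<notin> weights l V}"

definition dom_max_weights :: "nat \<Rightarrow> 'v::ab_group_add chevalley \<Rightarrow> weight set" where
  "dom_max_weights l V = max_weights l V \<inter> dominant l"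

section \<open>The linear system\<close>

definition Y_vec :: "nat \<Rightarrow> weight \<Rightarrow> weight \<Rightarrow> int vec" where
  "Y_vec l \<Lambda> \<Lambda>' = vec (l + 1) (\<lambda>i. coroot i (\<Lambda> - \<Lambda>'))"

definition min_solution :: "nat \<Rightarrow> weight \<Rightarrow> weight \<Rightarrow> int vec \<Rightarrow> bool" where
  "min_solution l \<Lambda> \<Lambda>' X \<longleftrightarrow>
     X \<in> carrier_vec (l + 1) \<and> (\<forall>i\<le>l. 0 \<le> X $ i) \<and> Min ((\<lambda>i. X $ i) ` {..l}) = 0 \<and>
     cartan l *\<^sub>v X = Y_vec l \<Lambda> \<Lambda>'"

section \<open>Consistency of the conventions\<close>

lemma coroot_fund_weight: "coroot i (fund_weight j) = (if i = j then 1 else 0)"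
  by (simp add: coroot_def fund_weight_def)

lemma coroot_null_root: "coroot i null_root = 0"
  by (simp add: coroot_def null_root_def)

lemma lookup_simple_root_Fund:
  assumes "j \<le> l"
  shows "Poly_Mapping.lookup (simple_root l i) (Fund j) = acoef l j i"
proof -
  have "Poly_Mapping.lookup (simple_root l i) (Fund j) =
      (\<Sum>m\<le>l. acoef l m i * (if Fund j = Fund m then 1 else 0))"
    by (simp add: simple_root_def lookup_add lookup_sum fund_weight_def null_root_def)
  also have "\<dots> = (\<Sum>m\<le>l. if j = m then acoef l m i else 0)"
    by (intro sum.cong) auto
  finally show ?thesis using assms by simp
qed

lemma coroot_simple_root: "i \<le> l \<Longrightarrow> coroot i (simple_root l j) = acoef l i j"
  by (simp add: coroot_def lookup_simple_root_Fund)

lemma scaling_simple_root: "scaling (simple_root l i) = (if i = 0 then 1 else 0)"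
  by (simp add: scaling_def simple_root_def lookup_add lookup_sum fund_weight_def null_root_def)

lemma keys_simple_root: "Poly_Mapping.keys (simple_root l i) \<subseteq> basis l"
proof -
  have "x \<in> basis l" if "Poly_Mapping.lookup (simple_root l i) x \<noteq> 0" for x
  proof (rule ccontr)
    assume "x \<notin> basis l"
    hence "\<forall>m\<le>l. Fund m \<noteq> x" "x \<noteq> Null" by (auto simp: basis_def)
    hence "Poly_Mapping.lookup (simple_root l i) x = 0"
      by (auto simp: simple_root_def lookup_add lookup_sum fund_weight_def null_root_def
        intro!: sum.neutral)
    with that show False by simp
  qed
  thus ?thesis by (auto simp: in_keys_iff)
qed

lemma acoef_sym: "acoef l i j = acoef l j i"
proof -
  have "[int i - int j = c] (mod n) \<longleftrightarrow> [int j - int i = - c] (mod n)" for c n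
    using cong_minus_minus_iff[of "int i - int j" c n] by simp
  from this[of 1] this[of "-1"] show ?thesis unfolding acoef_def by auto
qed

lemma acoef_alt:
  assumes "1 \<le> l" "m \<le> l" "i \<le> l"
  shows "acoef l m i = 2 * of_bool (m = i) - of_bool (m = (if i = l then 0 else i + 1))
     - of_bool (m = (if i = 0 then l else i - 1))"
proof -
  have c1: "[int m - int i = 1] (mod int (l + 1)) \<longleftrightarrow> m = (if i = l then 0 else i + 1)"
  proof
    assume "[int m - int i = 1] (mod int (l + 1))"
    then obtain q where q: "int m - int i - 1 = int (l + 1) * q"
      by (auto simp: cong_iff_dvd_diff)
    have "q = 0 \<or> q = -1"
    proof (rule ccontr)
      assume "\<not> ?thesis"
      hence "q \<ge> 1 \<or> q \<le> -2" by linarith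
      thus False
      proof
        assume "q \<ge> 1"
        hence "int (l + 1) * 1 \<le> int (l + 1) * q" by (intro mult_left_mono) auto
        thus False using assms unfolding q[symmetric] by auto
      next
        assume "q \<le> -2"
        hence "int (l + 1) * q \<le> int (l + 1) * (-2)" by (intro mult_left_mono) auto
        thus False using assms unfolding q[symmetric] by auto
      qed
    qed
    thus "m = (if i = l then 0 else i + 1)" using q assms by auto
  next
    assume m: "m = (if i = l then 0 else i + 1)"
    have "1 + int l dvd - int l - 1" by (rule dvdI[of _ _ "-1"]) simp
    with m show "[int m - int i = 1] (mod int (l + 1))"
      by (auto simp: cong_iff_dvd_diff split: if_splits)
  qed
  have c2: "[int m - int i = -1] (mod int (l + 1)) \<longleftrightarrow> m = (if i = 0 then l else i - 1)"
  proof
    assume "[int m - int i = -1] (mod int (l + 1))"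
    then obtain q where q: "int m - int i + 1 = int (l + 1) * q"
      by (auto simp: cong_iff_dvd_diff)
    have "q = 0 \<or> q = 1"
    proof (rule ccontr)
      assume "\<not> ?thesis"
      hence "q \<ge> 2 \<or> q \<le> -1" by linarith
      thus False
      proof
        assume "q \<ge> 2"
        hence "int (l + 1) * 2 \<le> int (l + 1) * q" by (intro mult_left_mono) auto
        thus False using assms unfolding q[symmetric] by auto
      next
        assume "q \<le> -1"
        hence "int (l + 1) * q \<le> int (l + 1) * (-1)" by (intro mult_left_mono) auto
        thus False using assms unfolding q[symmetric] by auto
      qed
    qed
    thus "m = (if i = 0 then l else i - 1)" using q assms by auto
  next
    assume "m = (if i = 0 then l else i - 1)"
    thus "[int m - int i = -1] (mod int (l + 1))"
      by (auto simp: cong_iff_dvd_diff of_nat_diff add.commute[of "int l" 1] split: if_splits)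
  qed
  show ?thesis
  proof (cases "l = 1")
    case True
    thus ?thesis using assms by (auto simp: acoef_def)
  next
    case False
    thus ?thesis using assms unfolding acoef_def c1 c2 by (auto split: if_splits)
  qed
qed

lemma sum_acoef:
  fixes g :: "nat \<Rightarrow> real"
  assumes "1 \<le> l" "i \<le> l"
  shows "(\<Sum>m\<le>l. real_of_int (acoef l m i) * g m) =
     2 * g i - g (if i = l then 0 else i + 1) - g (if i = 0 then l else i - 1)"
proof -
  let ?s = "if i = l then 0 else i + 1" and ?p = "if i = 0 then l else i - 1"
  have "(\<Sum>m\<le>l. real_of_int (acoef l m i) * g m) =
     (\<Sum>m\<le>l. 2 * (if m = i then g m else 0) - (if m = ?s then g m else 0)
        - (if m = ?p then g m else 0))"
    by (intro sum.cong refl) (subst acoef_alt[OF assms(1) _ assms(2)], auto simp: of_bool_def)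
  also have "\<dots> = 2 * g i - g ?s - g ?p"
    using assms by (simp only: sum_subtractf sum_distrib_left[symmetric] sum.delta finite_atMost)
      auto
  finally show ?thesis .
qed

lemma sum_simple_root:
  assumes "1 \<le> l"
  shows "(\<Sum>i\<le>l. simple_root l i) = null_root"
proof (rule poly_mapping_eqI)
  fix x
  show "Poly_Mapping.lookup (\<Sum>i\<le>l. simple_root l i) x = Poly_Mapping.lookup null_root x"
  proof (cases x)
    case Null
    thus ?thesis
      using scaling_simple_root[of l] by (simp add: lookup_sum scaling_def null_root_def)
  next
    case (Fund j)
    show ?thesis
    proof (cases "j \<le> l")
      case True
      have "real_of_int (\<Sum>i\<le>l. acoef l j i) = (\<Sum>i\<le>l. real_of_int (acoef l i j) * 1)"
        by (simp add: acoef_sym)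
      also have "\<dots> = 0" using sum_acoef[OF assms True, of "\<lambda>_. 1"] by simp
      finally have "(\<Sum>i\<le>l. acoef l j i) = 0" by linarith
      thus ?thesis using True Fund by (simp add: lookup_sum lookup_simple_root_Fund null_root_def)
    next
      case False
      hence "x \<notin> basis l" using Fund by (auto simp: basis_def)
      hence "\<forall>i. Poly_Mapping.lookup (simple_root l i) x = 0"
        using keys_simple_root by (metis in_keys_iff subsetD)
      thus ?thesis using Fund by (simp add: lookup_sum null_root_def)
    qed
  qed
qed

lemma lookup_of_weight: "Poly_Mapping.lookup (of_weight \<mu>) x = real_of_int (Poly_Mapping.lookup \<mu> x)"
  by (simp add: of_weight_def map.rep_eq when_def)

lemma lookup_rcmul: "Poly_Mapping.lookup (rcmul c v) x = c * Poly_Mapping.lookup v x"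
  by (simp add: rcmul_def map.rep_eq when_def)

lemma sum_basis: "(\<Sum>a\<in>basis l. g a) = g Null + (\<Sum>i\<le>l. g (Fund i))"
  for g :: "wt_basis \<Rightarrow> real"
proof -
  have "(\<Sum>a\<in>basis l. g a) = g Null + (\<Sum>a\<in>Fund ` {..l}. g a)"
    unfolding basis_def by (subst sum.insert) auto
  also have "(\<Sum>a\<in>Fund ` {..l}. g a) = (\<Sum>i\<le>l. g (Fund i))"
    by (subst sum.reindex) (auto simp: inj_on_def)
  finally show ?thesis .
qed

lemma form_add_left: "form l (u + v) w = form l u w + form l v w"
  by (simp add: form_def lookup_add algebra_simps sum.distrib)

lemma form_rcmul_left: "form l (rcmul c v) w = c * form l v w"
  by (simp add: form_def lookup_rcmul sum_distrib_left mult.assoc)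

lemma gram_sym: "gram l a b = gram l b a"
  by (cases a; cases b) (auto simp: min.commute mult.commute)

lemma form_sym: "form l v w = form l w v"
  unfolding form_def by (subst sum.swap) (simp add: gram_sym mult.commute mult.left_commute)

lemma form_simple_root:
  assumes "1 \<le> l" "i \<le> l"
  shows "form l (of_weight (simple_root l i)) w = Poly_Mapping.lookup w (Fund i)"
proof -
  let ?r = "\<lambda>b. \<Sum>a\<in>basis l. real_of_int (Poly_Mapping.lookup (simple_root l i) a) * gram l a b"
  have N: "Poly_Mapping.lookup (simple_root l i) Null = (if i = 0 then 1 else 0)"
    using scaling_simple_root[of l i] by (simp add: scaling_def)
  have r: "?r b = of_bool (i = 0) * gram l Null b + (\<Sum>m\<le>l. real_of_int (acoef l m i) * gram l (Fund m) b)"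
    for b
    unfolding sum_basis by (simp add: lookup_simple_root_Fund N)
  have rN: "?r Null = 0"
    unfolding r using sum_acoef[OF assms, of "\<lambda>m. gram l (Fund m) Null"] by simp
  have rF: "?r (Fund j) = of_bool (j = i)" if "j \<le> l" for j
  proof -
    define c where "c = 1 / real (l + 1)"
    have g: "gram l (Fund m) (Fund j) = real (min m j) - real m * (real j * c)" for m
      by (simp add: c_def)
    have "real j * c * (real l + 1) = real j" by (simp add: c_def add.commute)
    hence c: "real l * (real j * c) = real j - real j * c" by (simp add: algebra_simps)
    consider "i = 0" | p where "i = Suc p" "i < l" | p where "i = Suc p" "i = l"
      using assms by (cases i; cases "i < l") auto
    thus ?thesis
    proof cases
      case 1
      thus ?thesis unfolding r sum_acoef[OF assms] g using that assms c
        by (cases "j = 0") (auto simp: min_def)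
    next
      case 2
      thus ?thesis unfolding r sum_acoef[OF assms] g using that
        by (auto simp: min_def algebra_simps of_nat_diff)
    next
      case 3
      thus ?thesis unfolding r sum_acoef[OF assms] g using that c
        by (cases "j = l") (auto simp: min_def algebra_simps)
    qed
  qed
  have "form l (of_weight (simple_root l i)) w = (\<Sum>b\<in>basis l. Poly_Mapping.lookup w b * ?r b)"
    unfolding form_def
    by (subst sum.swap) (simp add: lookup_of_weight sum_distrib_left mult.assoc mult.left_commute)
  also have "\<dots> = (\<Sum>j\<le>l. Poly_Mapping.lookup w (Fund j) * of_bool (j = i))"
    unfolding sum_basis[of "\<lambda>b. Poly_Mapping.lookup w b * ?r b"] rN using rF by simp
  also have "\<dots> = (\<Sum>j\<le>l. if j = i then Poly_Mapping.lookup w (Fund j) else 0)"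
    by (intro sum.cong) auto
  also have "\<dots> = Poly_Mapping.lookup w (Fund i)" using assms by simp
  finally show ?thesis .
qed

lemma form_fund_weight_0: "form l (of_weight (fund_weight 0)) w = Poly_Mapping.lookup w Null"
proof -
  have *: "real_of_int (Poly_Mapping.lookup (fund_weight 0) (Fund m)) = of_bool (m = 0)"
    "Poly_Mapping.lookup (fund_weight 0) Null = 0" for m
    by (auto simp: fund_weight_def)
  have s: "(\<Sum>m\<le>l. of_bool (m = 0) * g m) = g 0" for g :: "nat \<Rightarrow> real"
    by (subst sum.cong[OF refl, of _ _ "\<lambda>m. if m = 0 then g m else 0"]) auto
  have "form l (of_weight (fund_weight 0)) w =
     (\<Sum>a\<in>basis l. real_of_int (Poly_Mapping.lookup (fund_weight 0) a) *
        (\<Sum>b\<in>basis l. Poly_Mapping.lookup w b * gram l a b))"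
    by (simp add: form_def lookup_of_weight sum_distrib_left mult.assoc)
  also have "\<dots> = (\<Sum>b\<in>basis l. Poly_Mapping.lookup w b * gram l (Fund 0) b)"
    by (subst sum_basis) (simp add: * s)
  also have "\<dots> = Poly_Mapping.lookup w Null"
    by (subst sum_basis) simp
  finally show ?thesis .
qed

lemma form_simple_root_simple_root:
  assumes "1 \<le> l" "i \<le> l" "j \<le> l"
  shows "form l (of_weight (simple_root l i)) (of_weight (simple_root l j)) = real_of_int (acoef l i j)"
  using assms by (simp add: form_simple_root lookup_of_weight lookup_simple_root_Fund)

lemma form_simple_root_fund_weight_0:
  assumes "1 \<le> l" "i \<le> l"
  shows "form l (of_weight (simple_root l i)) (of_weight (fund_weight 0)) = (if i = 0 then 1 else 0)"
  using assms by (simp add: form_simple_root lookup_of_weight fund_weight_def)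

lemma form_null_root:
  "form l (of_weight null_root) (of_weight (fund_weight 0)) = 1"
  "form l (of_weight null_root) (of_weight null_root) = 0"
  "form l (of_weight (fund_weight 0)) (of_weight (fund_weight 0)) = 0"
proof -
  show "form l (of_weight null_root) (of_weight (fund_weight 0)) = 1"
    by (subst form_sym) (simp add: form_fund_weight_0 lookup_of_weight null_root_def)
  show "form l (of_weight null_root) (of_weight null_root) = 0"
    unfolding form_def sum_basis by (simp add: lookup_of_weight null_root_def)
  show "form l (of_weight (fund_weight 0)) (of_weight (fund_weight 0)) = 0"
    unfolding form_fund_weight_0 by (simp add: lookup_of_weight fund_weight_def)
qed

lemma form_nondegenerate:
  assumes "1 \<le> l" "w \<in> real_span l" "\<forall>v\<in>real_span l. form l v w = 0"
  shows "w = 0"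
proof -
  have in_span: "of_weight \<mu> \<in> real_span l" if "Poly_Mapping.keys \<mu> \<subseteq> basis l" for \<mu>
    using that by (auto simp: real_span_def in_keys_iff lookup_of_weight)
  have "of_weight (fund_weight 0) \<in> real_span l"
    by (intro in_span) (auto simp: fund_weight_def basis_def)
  hence "Poly_Mapping.lookup w Null = 0"
    using assms(3) form_fund_weight_0[of l w] by auto
  moreover have "Poly_Mapping.lookup w (Fund i) = 0" if "i \<le> l" for i
    using form_simple_root[OF assms(1) that, of w] assms(3) in_span[OF keys_simple_root] by auto
  ultimately have "Poly_Mapping.lookup w x = 0" for x
    using assms(2) by (cases "x \<in> basis l") (auto simp: basis_def real_span_def in_keys_iff)
  thus ?thesis by (intro poly_mapping_eqI) simp
qed

end

theory Submission
  imports Defs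
begin

text \<open>
  Weights of \<open>V(\<Lambda>)\<close> have the form \<open>\<Lambda> - \<Sum>\<^sub>i x\<^sub>i \<alpha>\<^sub>i\<close> with \<open>x \<ge> 0\<close>, and for positive
  level every dominant element of this form is a weight.  As \<open>\<delta> = \<Sum>\<^sub>i \<alpha>\<^sub>i\<close>, adding \<open>\<delta>\<close> lowers
  all \<open>x\<^sub>i\<close> by one, so a dominant weight is maximal iff \<open>min\<^sub>i x\<^sub>i = 0\<close>.  Since \<open>\<phi>\<close> only
  removes the \<open>\<delta>\<close>-part, \<open>\<phi>(\<mu>) = \<Lambda>'\<close> says that \<open>\<mu>\<close> and \<open>\<Lambda>'\<close> agree on all coroots, which is the
  linear system \<open>A x = Y\<close>.  The kernel of \<open>A\<close> is spanned by \<open>(1, \<dots>, 1)\<close>, and the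
  system is solvable over the integers exactly on the sieving class.
\<close>

section \<open>The root lattice and the affine Cartan matrix\<close>

definition root_comb :: "nat \<Rightarrow> (nat \<Rightarrow> int) \<Rightarrow> weight" where
  "root_comb l x = (\<Sum>i\<le>l. frag_cmul (x i) (simple_root l i))"

text \<open>The pairing with the canonical central element, the sum of all \<open>h_i\<close>; it is
  also \<open>(\<delta>, \<mu>)\<close>.\<close>

definition level :: "nat \<Rightarrow> weight \<Rightarrow> int" where
  "level l \<mu> = (\<Sum>i\<le>l. coroot i \<mu>)"

section \<open>Coordinates on the weight lattice\<close>

lemma coroot_add: "coroot i (\<mu> + \<nu>) = coroot i \<mu> + coroot i \<nu>"
  and coroot_diff: "coroot i (\<mu> - \<nu>) = coroot i \<mu> - coroot i \<nu>"
  and scaling_diff: "scaling (\<mu> - \<nu>) = scaling \<mu> - scaling \<nu>"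
  by (simp_all add: coroot_def scaling_def lookup_add lookup_minus)

lemma level_diff: "level l (\<mu> - \<nu>) = level l \<mu> - level l \<nu>"
  by (simp add: level_def coroot_diff sum_subtractf)

lemma lookup_eq_0_outside_basis:
  "\<mu> \<in> weight_lattice l \<Longrightarrow> x \<notin> basis l \<Longrightarrow> Poly_Mapping.lookup \<mu> x = 0"
  by (metis (mono_tags) in_keys_iff mem_Collect_eq subsetD weight_lattice_def)

lemma weight_latticeI:
  "(\<And>x. x \<notin> basis l \<Longrightarrow> Poly_Mapping.lookup \<mu> x = 0) \<Longrightarrow> \<mu> \<in> weight_lattice l"
  by (auto simp: weight_lattice_def in_keys_iff)

lemma weight_lattice_add: "\<mu> \<in> weight_lattice l \<Longrightarrow> \<nu> \<in> weight_lattice l \<Longrightarrow> \<mu> + \<nu> \<in> weight_lattice l"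
  and weight_lattice_diff: "\<mu> \<in> weight_lattice l \<Longrightarrow> \<nu> \<in> weight_lattice l \<Longrightarrow> \<mu> - \<nu> \<in> weight_lattice l"
  by (auto intro!: weight_latticeI simp: lookup_add lookup_minus lookup_eq_0_outside_basis)

lemma simple_root_in_weight_lattice: "simple_root l i \<in> weight_lattice l"
  by (simp add: weight_lattice_def keys_simple_root)

lemma null_root_in_weight_lattice: "null_root \<in> weight_lattice l"
  by (auto intro!: weight_latticeI simp: null_root_def basis_def)

lemma root_comb_in_weight_lattice: "root_comb l x \<in> weight_lattice l"
  by (auto intro!: weight_latticeI sum.neutral
      simp: root_comb_def lookup_sum lookup_eq_0_outside_basis[OF simple_root_in_weight_lattice])

lemma weight_eqI:
  assumes "\<mu> \<in> weight_lattice l" "\<nu> \<in> weight_lattice l"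
    and "\<And>i. i \<le> l \<Longrightarrow> coroot i \<mu> = coroot i \<nu>" "scaling \<mu> = scaling \<nu>"
  shows "\<mu> = \<nu>"
proof (rule poly_mapping_eqI)
  fix x
  show "Poly_Mapping.lookup \<mu> x = Poly_Mapping.lookup \<nu> x"
  proof (cases "x \<in> basis l")
    case True
    thus ?thesis using assms by (auto simp: basis_def coroot_def scaling_def)
  qed (use assms in \<open>simp add: lookup_eq_0_outside_basis\<close>)
qed

section \<open>Pairings with elements of the root lattice\<close>

lemma sum_acoef_int:
  fixes x :: "nat \<Rightarrow> int"
  assumes "1 \<le> l" "i \<le> l"
  shows "(\<Sum>j\<le>l. acoef l i j * x j) =
     2 * x i - x (if i = l then 0 else i + 1) - x (if i = 0 then l else i - 1)"
proof -
  have "real_of_int (\<Sum>j\<le>l. acoef l i j * x j) = (\<Sum>j\<le>l. real_of_int (acoef l j i) * real_of_int (x j))"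
    by (simp add: acoef_sym[of l i])
  also have "\<dots> = real_of_int (2 * x i - x (if i = l then 0 else i + 1) - x (if i = 0 then l else i - 1))"
    by (subst sum_acoef[OF assms]) simp
  finally show ?thesis by (simp only: of_int_eq_iff)
qed

lemma coroot_root_comb_sum: "i \<le> l \<Longrightarrow> coroot i (root_comb l x) = (\<Sum>j\<le>l. acoef l i j * x j)"
  by (simp add: root_comb_def coroot_def lookup_sum lookup_simple_root_Fund mult.commute)

text \<open>The two subtracted terms come from the neighbours of \<open>i\<close> on the cycle; for
  \<open>l = 1\<close> the neighbours coincide, which accounts for the entry -2.\<close>

lemma coroot_root_comb:
  assumes "1 \<le> l" "i \<le> l"
  shows "coroot i (root_comb l x) =
     2 * x i - x (if i = l then 0 else i + 1) - x (if i = 0 then l else i - 1)"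
  using assms by (simp only: coroot_root_comb_sum sum_acoef_int)

lemma scaling_root_comb: "scaling (root_comb l x) = x 0"
proof -
  have "scaling (root_comb l x) = (\<Sum>i\<le>l. x i * scaling (simple_root l i))"
    by (simp add: root_comb_def scaling_def lookup_sum)
  also have "\<dots> = (\<Sum>i\<le>l. if i = 0 then x i else 0)"
    by (intro sum.cong) (auto simp: scaling_simple_root)
  finally show ?thesis by simp
qed

lemma level_root_comb:
  assumes "1 \<le> l"
  shows "level l (root_comb l x) = 0"
proof -
  have "level l (root_comb l x) = (\<Sum>i\<le>l. \<Sum>j\<le>l. acoef l i j * x j)"
    by (simp add: level_def coroot_root_comb_sum)
  also have "\<dots> = (\<Sum>j\<le>l. x j * (\<Sum>i\<le>l. acoef l j i * 1))"
    by (subst sum.swap) (simp add: sum_distrib_left acoef_sym mult.commute)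
  also have "\<dots> = 0"
    by (intro sum.neutral ballI) (simp only: sum_acoef_int[OF assms] atMost_iff, simp)
  finally show ?thesis .
qed

lemma root_comb_cong: "(\<And>i. i \<le> l \<Longrightarrow> x i = y i) \<Longrightarrow> root_comb l x = root_comb l y"
  unfolding root_comb_def by (rule sum.cong) auto

lemma root_comb_diff: "root_comb l (\<lambda>i. x i - y i) = root_comb l x - root_comb l y"
  by (simp add: root_comb_def frag_cmul_diff_distrib sum_subtractf)

lemma root_comb_add: "root_comb l (\<lambda>i. x i + y i) = root_comb l x + root_comb l y"
  by (simp add: root_comb_def frag_cmul_distrib sum.distrib)

lemma root_comb_0: "root_comb l (\<lambda>i. 0) = 0"
  by (simp add: root_comb_def)

lemma root_comb_1: "1 \<le> l \<Longrightarrow> root_comb l (\<lambda>i. 1) = null_root"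
  by (simp add: root_comb_def sum_simple_root)

lemma root_comb_single: "i \<le> l \<Longrightarrow> root_comb l (\<lambda>j. of_bool (j = i)) = simple_root l i"
proof -
  assume "i \<le> l"
  have "root_comb l (\<lambda>j. of_bool (j = i)) = (\<Sum>j\<le>l. if j = i then simple_root l j else 0)"
    unfolding root_comb_def by (rule sum.cong) auto
  thus ?thesis using \<open>i \<le> l\<close> by simp
qed

text \<open>Vanishing second differences make \<open>z\<close> an arithmetic progression on
  \<open>0..l\<close>. Row 0 closes the cycle and forces \<open>(l + 1) * d = 0\<close> for its
  increment \<open>d\<close>.\<close>

lemma cartan_kernel:
  assumes "1 \<le> l" and eq: "\<And>i. i \<le> l \<Longrightarrow> coroot i (root_comb l z) = 0"
  shows "i \<le> l \<Longrightarrow> z i = z 0"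
proof -
  define d where "d = z 1 - z 0"
  have step: "z (Suc n) = 2 * z n - z (n - 1)" if "1 \<le> n" "n < l" for n
    using eq[of n] that by (simp add: coroot_root_comb[OF assms(1)])
  have lin: "n < l \<Longrightarrow> z n = z 0 + int n * d \<and> z (Suc n) = z 0 + int (Suc n) * d" for n
  proof (induction n)
    case (Suc n)
    thus ?case using step[of "Suc n"] by (auto simp: algebra_simps)
  qed (simp add: d_def)
  have lin': "z n = z 0 + int n * d" if "n \<le> l" for n
  proof (cases n)
    case (Suc m)
    thus ?thesis using lin[of m] that by simp
  qed simp
  have "2 * z 0 - z 1 - z l = 0"
    using eq[of 0] assms(1) by (simp add: coroot_root_comb[OF assms(1)])
  hence "(int l + 1) * d = 0"
    using lin'[of l] by (simp add: d_def algebra_simps)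
  hence "d = 0" by simp
  thus "i \<le> l \<Longrightarrow> z i = z 0" using lin'[of i] by simp
qed

text \<open>The coroots see the coefficients only up to a common constant; the scaling, which is
  \<open>x 0\<close>, fixes that constant.\<close>

lemma root_comb_inject:
  assumes "1 \<le> l" "root_comb l x = root_comb l y" "i \<le> l"
  shows "x i = y i"
proof -
  have *: "root_comb l (\<lambda>i. x i - y i) = 0" using assms by (simp add: root_comb_diff)
  have "x i - y i = x 0 - y 0"
    by (rule cartan_kernel[OF assms(1) _ assms(3)]) (simp add: * coroot_def)
  moreover have "x 0 - y 0 = 0"
    using * scaling_root_comb[of l "\<lambda>i. x i - y i"] by (simp add: scaling_def)
  ultimately show ?thesis by simp
qed

text \<open>This makes the sieving congruence necessary: moving within the root lattice changes
  \<open>ev\<close> by a multiple of \<open>l + 1\<close>. The weighted second differences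
  telescope.\<close>

lemma ev_root_comb:
  assumes "1 \<le> l"
  shows "ev l (root_comb l x) = int (l + 1) * (x l - x 0)"
proof -
  \<comment> \<open>Placing \<open>x 0\<close> also at index \<open>l + 1\<close> removes the
    wrap-around case from the induction.\<close>
  define z where "z = x(Suc l := x 0)"
  have "n \<le> l \<Longrightarrow> (\<Sum>i=1..n. int i * (2 * z i - z (i + 1) - z (i - 1))) =
      (int n + 1) * z n - int n * z (Suc n) - z 0" for n
    by (induction n) (auto simp: algebra_simps)
  note this[of l]
  moreover have "ev l (root_comb l x) = (\<Sum>i=1..l. int i * (2 * z i - z (i + 1) - z (i - 1)))"
    unfolding ev_def by (rule sum.cong) (auto simp: coroot_root_comb[OF assms] z_def)
  ultimately show ?thesis by (simp add: z_def algebra_simps)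
qed

text \<open>
  Since the Cartan matrix is a cyclic negative second difference, the system is solved by summing
  twice; \<open>level l \<mu> = 0\<close> and the congruence are the conditions for the two sums to close up.
\<close>

lemma ex_root_comb:
  assumes "1 \<le> l" "level l \<mu> = 0" "int (l + 1) dvd ev l \<mu>"
  shows "\<exists>x. \<forall>i\<le>l. coroot i (root_comb l x) = coroot i \<mu>"
proof -
  define y where "y i = coroot i \<mu>" for i
  obtain c where c: "ev l \<mu> = int (l + 1) * c" using assms(3) by blast
  \<comment> \<open>\<open>d\<close> is the first difference of the solution. Its free constant is
    chosen as \<open>- c\<close> so that the \<open>l + 1\<close> differences add up to 0:
    exchanging the two summations, as in \<open>x_eq\<close>, turns the double sum of
    \<open>y\<close> into \<open>ev l \<mu>\<close>.\<close>
  define d where "d i = - c - (\<Sum>j\<le>i. y j)" for i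
  define x where "x n = (\<Sum>i<n. d i)" for n
  have x_eq: "x n = (\<Sum>j<n. int j * y j) - int n * (c + (\<Sum>j<n. y j))" for n
    by (induction n) (auto simp: x_def d_def algebra_simps lessThan_Suc_atMost[symmetric])
  have dl: "d l = - c" using assms(2) by (simp add: d_def level_def y_def)
  have "(\<Sum>j<Suc l. int j * y j) = ev l \<mu>"
    unfolding ev_def y_def lessThan_Suc_atMost
    by (rule sum.mono_neutral_right) auto
  moreover have "(\<Sum>j<Suc l. y j) = 0"
    using assms(2) by (simp only: lessThan_Suc_atMost level_def y_def)
  ultimately have closed: "x (Suc l) = 0"
    unfolding x_eq using c by simp
  have x0: "x 0 = 0" by (simp add: x_def)
  have xS: "x (Suc n) = x n + d n" for n by (simp add: x_def)
  have "coroot i (root_comb l x) = y i" if "i \<le> l" for i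
  proof (cases i)
    case 0
    have "x l = c" using closed xS[of l] dl by simp
    thus ?thesis using 0 assms(1) x0 xS[of 0] by (simp add: coroot_root_comb d_def)
  next
    case (Suc m)
    have "x (if i = l then 0 else i + 1) = x (Suc i)"
      using closed x0 by simp
    thus ?thesis using Suc that xS[of i] xS[of m] unfolding coroot_root_comb[OF assms(1) that]
      by (simp add: d_def)
  qed
  thus ?thesis unfolding y_def by blast
qed

section \<open>The map \<open>\<phi>\<close> in coordinates\<close>

lemma P_cl_iff:
  "\<mu> \<in> P_cl l k \<longleftrightarrow> \<mu> \<in> dominant l \<and> level l \<mu> = int k \<and> scaling \<mu> = 0"
proof
  assume "\<mu> \<in> P_cl l k"
  then obtain m where m: "\<mu> = (\<Sum>i\<le>l. frag_cmul (int (m i)) (fund_weight i))" "(\<Sum>i\<le>l. m i) = k"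
    by (auto simp: P_cl_def)
  have cr: "coroot j \<mu> = int (m j)" if "j \<le> l" for j
  proof -
    have "coroot j \<mu> = (\<Sum>i\<le>l. if j = i then int (m i) else 0)"
      unfolding m(1) coroot_def lookup_sum by (rule sum.cong) (auto simp: fund_weight_def)
    thus ?thesis using that by simp
  qed
  moreover have "\<mu> \<in> weight_lattice l"
    by (auto intro!: weight_latticeI sum.neutral simp: m(1) lookup_sum fund_weight_def basis_def)
  moreover have "scaling \<mu> = 0"
    by (simp add: m(1) scaling_def lookup_sum fund_weight_def)
  moreover have "level l \<mu> = int k"
    using cr m(2) by (simp add: level_def flip: of_nat_sum)
  ultimately show "\<mu> \<in> dominant l \<and> level l \<mu> = int k \<and> scaling \<mu> = 0"
    by (simp add: dominant_def)
next
  assume \<mu>: "\<mu> \<in> dominant l \<and> level l \<mu> = int k \<and> scaling \<mu> = 0"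
  define m where "m i = nat (coroot i \<mu>)" for i
  have m: "int (m i) = coroot i \<mu>" if "i \<le> l" for i
    using \<mu> that by (simp add: m_def dominant_def)
  have "int (\<Sum>i\<le>l. m i) = int k" using \<mu> m by (simp add: level_def)
  moreover have "\<mu> = (\<Sum>i\<le>l. frag_cmul (int (m i)) (fund_weight i))"
  proof (rule weight_eqI[of _ l])
    show "\<mu> \<in> weight_lattice l" using \<mu> by (simp add: dominant_def)
    show "(\<Sum>i\<le>l. frag_cmul (int (m i)) (fund_weight i)) \<in> weight_lattice l"
      by (auto intro!: weight_latticeI sum.neutral simp: lookup_sum fund_weight_def basis_def)
    show "scaling \<mu> = scaling (\<Sum>i\<le>l. frag_cmul (int (m i)) (fund_weight i))"
      using \<mu> by (simp add: scaling_def lookup_sum fund_weight_def)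
    fix i assume "i \<le> l"
    have "coroot i (\<Sum>i\<le>l. frag_cmul (int (m i)) (fund_weight i)) = (\<Sum>j\<le>l. if i = j then int (m j) else 0)"
      unfolding coroot_def lookup_sum by (rule sum.cong) (auto simp: fund_weight_def)
    thus "coroot i \<mu> = coroot i (\<Sum>i\<le>l. frag_cmul (int (m i)) (fund_weight i))"
      using \<open>i \<le> l\<close> m by simp
  qed
  ultimately show "\<mu> \<in> P_cl l k" unfolding P_cl_def by (auto simp del: of_nat_sum)
qed

lemma form_null_root_left:
  "form l (of_weight null_root) (of_weight \<mu>) = real_of_int (level l \<mu>)"
proof -
  have "form l (of_weight null_root) (of_weight \<mu>) =
      (\<Sum>b\<in>basis l. real_of_int (Poly_Mapping.lookup \<mu> b) * gram l Null b)"
    unfolding form_def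
    by (subst sum_basis) (simp add: lookup_of_weight null_root_def)
  thus ?thesis by (simp add: sum_basis level_def coroot_def)
qed

text \<open>Removing the \<open>\<Lambda>_0\<close> component lowers only the coordinate at
  \<open>Fund 0\<close>, by the level; removing the \<open>\<delta>\<close> component clears
  \<open>Null\<close>.\<close>

lemma lookup_bar:
  "Poly_Mapping.lookup (bar l \<mu>) (Fund i) =
     real_of_int (coroot i \<mu>) - (if i = 0 then real_of_int (level l \<mu>) else 0)"
  "Poly_Mapping.lookup (bar l \<mu>) Null = 0"
  unfolding bar_def lookup_minus lookup_rcmul lookup_of_weight form_null_root_left form_fund_weight_0
  by (auto simp: coroot_def fund_weight_def null_root_def)

lemma level_fund_weight: "i \<le> l \<Longrightarrow> level l (fund_weight i) = 1"
  by (simp add: level_def coroot_fund_weight)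

text \<open>The coordinates at \<open>Fund j\<close> with \<open>1 \<le> j \<le> l\<close> read off
  the coefficients. The one at \<open>Fund 0\<close> then agrees by itself, being minus the sum of
  these on both sides.\<close>

lemma bar_eq_sum_iff:
  assumes "\<mu> \<in> weight_lattice l"
  shows "bar l \<mu> = (\<Sum>i=1..l. rcmul (real_of_int (m i)) (bar l (fund_weight i))) \<longleftrightarrow>
     (\<forall>i\<in>{1..l}. m i = coroot i \<mu>)" (is "_ = ?s \<longleftrightarrow> _")
proof -
  have N: "Poly_Mapping.lookup ?s Null = 0"
    by (simp add: lookup_sum lookup_rcmul lookup_bar)
  have F: "Poly_Mapping.lookup ?s (Fund j) = (if j \<in> {1..l} then real_of_int (m j) else 0)" if "j \<noteq> 0" for j
  proof -
    have "Poly_Mapping.lookup ?s (Fund j) = (\<Sum>i=1..l. if j = i then real_of_int (m i) else 0)"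
      unfolding lookup_sum by (rule sum.cong) (use that in \<open>auto simp: lookup_rcmul lookup_bar coroot_fund_weight\<close>)
    thus ?thesis by simp
  qed
  have F0: "Poly_Mapping.lookup ?s (Fund 0) = - (\<Sum>i=1..l. real_of_int (m i))"
    unfolding lookup_sum sum_negf[symmetric]
    by (rule sum.cong) (auto simp: lookup_rcmul lookup_bar coroot_fund_weight level_fund_weight)
  show ?thesis
  proof
    assume *: "bar l \<mu> = ?s"
    show "\<forall>i\<in>{1..l}. m i = coroot i \<mu>"
    proof
      fix i assume "i \<in> {1..l}"
      thus "m i = coroot i \<mu>" using F[of i] lookup_bar(1)[of l \<mu> i] unfolding * by simp
    qed
  next
    assume *: "\<forall>i\<in>{1..l}. m i = coroot i \<mu>"
    have lev: "level l \<mu> = coroot 0 \<mu> + (\<Sum>i=1..l. coroot i \<mu>)"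
      by (simp add: level_def sum.atMost_shift sum.atLeast1_atMost_eq lessThan_Suc_atMost)
    show "bar l \<mu> = ?s"
    proof (rule poly_mapping_eqI)
      fix x
      consider "x = Null" | "x = Fund 0" | j where "x = Fund j" "j \<in> {1..l}"
        | j where "x = Fund j" "j > l" "j \<noteq> 0"
        by (metis One_nat_def Suc_leI atLeastAtMost_iff gr_zeroI not_le wt_basis.exhaust)
      thus "Poly_Mapping.lookup (bar l \<mu>) x = Poly_Mapping.lookup ?s x"
      proof cases
        case 1 thus ?thesis by (simp only: N lookup_bar)
      next
        case 2 
        have "(\<Sum>i=1..l. m i) = (\<Sum>i=1..l. coroot i \<mu>)" using * by (intro sum.cong) auto
        thus ?thesis unfolding 2 F0 lookup_bar using lev by (simp flip: of_int_sum)
      next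
        case 3 thus ?thesis using F[of j] * by (simp add: lookup_bar)
      next
        case 4
        hence "coroot j \<mu> = 0" unfolding coroot_def
          by (intro lookup_eq_0_outside_basis[OF assms]) (auto simp: basis_def)
        thus ?thesis using 4 F[of j] by (simp add: lookup_bar)
      qed
    qed
  qed
qed

text \<open>The level hypothesis identifies the coefficient of \<open>\<Lambda>_0\<close>,
  \<open>k\<close> minus the other coefficients, with \<open>coroot 0 \<mu>\<close>; hence only the
  \<open>\<delta>\<close>-part is lost.\<close>

lemma phi_eq:
  assumes "\<mu> \<in> weight_lattice l" "level l \<mu> = int k"
  shows "phi l k \<mu> = \<mu> - frag_cmul (scaling \<mu>) null_root"
proof -
  let ?n = "\<lambda>m. frag_cmul (int k - (\<Sum>i=1..l. m i)) (fund_weight 0)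
            + (\<Sum>i=1..l. frag_cmul (m i) (fund_weight i))"
  have eq: "?n m = \<mu> - frag_cmul (scaling \<mu>) null_root" if m: "\<forall>i\<in>{1..l}. m i = coroot i \<mu>" for m
  proof (rule weight_eqI[of _ l])
    show "?n m \<in> weight_lattice l"
      by (auto intro!: weight_latticeI sum.neutral simp: lookup_add lookup_sum fund_weight_def basis_def)
    show "\<mu> - frag_cmul (scaling \<mu>) null_root \<in> weight_lattice l"
      using lookup_eq_0_outside_basis[OF assms(1)]
      by (auto intro!: weight_latticeI simp: lookup_minus null_root_def basis_def)
    show "scaling (?n m) = scaling (\<mu> - frag_cmul (scaling \<mu>) null_root)"
      by (simp add: scaling_def lookup_add lookup_minus lookup_sum fund_weight_def null_root_def)
    fix i assume i: "i \<le> l"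
    have "(\<Sum>i=1..l. m i) = (\<Sum>i=1..l. coroot i \<mu>)" using m by (intro sum.cong) auto
    moreover have "level l \<mu> = coroot 0 \<mu> + (\<Sum>i=1..l. coroot i \<mu>)"
      by (simp add: level_def sum.atMost_shift sum.atLeast1_atMost_eq lessThan_Suc_atMost)
    ultimately have m0: "int k - (\<Sum>i=1..l. m i) = coroot 0 \<mu>" using assms(2) by simp
    have "coroot i (\<Sum>j=1..l. frag_cmul (m j) (fund_weight j)) = (\<Sum>j=1..l. if i = j then m j else 0)"
      unfolding coroot_def lookup_sum by (rule sum.cong) (auto simp: fund_weight_def)
    also have "\<dots> = (if i = 0 then 0 else coroot i \<mu>)" using i m by auto
    finally show "coroot i (?n m) = coroot i (\<mu> - frag_cmul (scaling \<mu>) null_root)"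
      unfolding m0 by (auto simp: coroot_add coroot_diff) (auto simp: coroot_def fund_weight_def null_root_def)
  qed
  \<comment> \<open>The function \<open>m\<close> is determined only on \<open>{1..l}\<close>, but
    the weight built from it uses no other values, so the description is unique.\<close>
  show ?thesis unfolding phi_def bar_eq_sum_iff[OF assms(1)]
  proof (rule the_equality)
    show "\<exists>m. (\<forall>i\<in>{1..l}. m i = coroot i \<mu>) \<and> \<mu> - frag_cmul (scaling \<mu>) null_root = ?n m"
      using eq[of "\<lambda>i. coroot i \<mu>"] by (intro exI[of _ "\<lambda>i. coroot i \<mu>"]) simp
  qed (use eq in blast)
qed

section \<open>Weights of an integrable highest weight module\<close>

locale affine_rep =
  fixes l :: nat and V :: "'v::ab_group_add chevalley"
  assumes affine: "affine_module l V"
begin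

sublocale vector_space "smult V"
  using affine by (simp add: affine_module_def)

lemma module_hom_E: "i \<le> l \<Longrightarrow> module_hom (smult V) (smult V) (E V i)"
  and module_hom_F: "i \<le> l \<Longrightarrow> module_hom (smult V) (smult V) (F V i)"
  and module_hom_H: "i \<le> l \<Longrightarrow> module_hom (smult V) (smult V) (H V i)"
  and module_hom_D: "module_hom (smult V) (smult V) (D V)"
  using affine by (simp_all add: affine_module_def linear_iff_module_hom)

lemma H_E: "i \<le> l \<Longrightarrow> j \<le> l \<Longrightarrow>
    H V i (E V j v) = E V j (H V i v) + smult V (of_int (coroot i (simple_root l j))) (E V j v)"
  and H_F: "i \<le> l \<Longrightarrow> j \<le> l \<Longrightarrow>
    H V i (F V j v) = F V j (H V i v) - smult V (of_int (coroot i (simple_root l j))) (F V j v)"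
  and D_F: "j \<le> l \<Longrightarrow>
    D V (F V j v) = F V j (D V v) - smult V (of_int (scaling (simple_root l j))) (F V j v)"
  and E_F: "i \<le> l \<Longrightarrow> j \<le> l \<Longrightarrow>
    E V i (F V j v) = F V j (E V i v) + (if i = j then H V i v else 0)"
  using affine by (auto simp: affine_module_def comm_def fun_eq_iff algebra_simps)

section \<open>Weight spaces and their independence\<close>

lemma subspace_weight_space: "subspace (weight_space l V \<mu>)"
  using module_hom.add[OF module_hom_H] module_hom.scale[OF module_hom_H]
    module_hom.add[OF module_hom_D] module_hom.scale[OF module_hom_D]
    module_hom.zero[OF module_hom_H] module_hom.zero[OF module_hom_D]
  by (auto intro!: subspaceI simp: weight_space_def algebra_simps)

lemma F_weight_space:
  assumes "j \<le> l" "v \<in> weight_space l V \<mu>"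
  shows "F V j v \<in> weight_space l V (\<mu> - simple_root l j)"
  using assms module_hom.scale[OF module_hom_F]
  by (auto simp: weight_space_def coroot_diff scaling_diff H_F D_F scale_left_diff_distrib)

text \<open>Some \<open>H V i\<close> or \<open>D V\<close> has different eigenvalues at
  \<open>w b\<close> and \<open>\<mu>\<close>. Subtracting its eigenvalue at \<open>w b\<close>
  kills the summand \<open>b\<close>, rescales the others and multiplies \<open>u\<close> by a
  nonzero scalar, so the induction hypothesis applies. Only \<open>\<mu>\<close> is singled out; the
  weights \<open>w a\<close> may repeat, as they do in an arbitrary expansion.\<close>

lemma weight_space_sum_eq_0:
  assumes "finite t" "u \<in> weight_space l V \<mu>" "u = (\<Sum>a\<in>t. f a)"
    and "\<And>a. a \<in> t \<Longrightarrow> f a \<in> weight_space l V (w a) \<and> w a \<in> weight_lattice l \<and> w a \<noteq> \<mu>"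
    and "\<mu> \<in> weight_lattice l"
  shows "u = 0"
  using assms(1-4)
proof (induction t arbitrary: u f rule: finite_induct)
  case (insert b t)
  have separated: "u = 0"
    if X: "module_hom (smult V) (smult V) X"
      and Xw: "\<And>v \<nu>. v \<in> weight_space l V \<nu> \<Longrightarrow> X v = smult V (of_int (c \<nu>)) v"
      and c: "c (w b) \<noteq> c \<mu>" for X c
  proof -
    let ?s = "\<lambda>\<nu>. of_int (c \<nu> - c (w b)) :: complex"
    have s: "smult V (?s \<nu>) v = X v - smult V (of_int (c (w b))) v"
      if "v \<in> weight_space l V \<nu>" for v \<nu>
      using Xw[OF that] by (simp add: scale_left_diff_distrib)
    have "smult V (?s \<mu>) u = X u - smult V (of_int (c (w b))) u"
      by (rule s[OF insert.prems(1)])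
    also have "\<dots> = (\<Sum>a\<in>insert b t. X (f a) - smult V (of_int (c (w b))) (f a))"
      unfolding insert.prems(2) using module_hom.sum[OF X] by (simp add: sum_subtractf scale_sum_right)
    also have "\<dots> = (\<Sum>a\<in>insert b t. smult V (?s (w a)) (f a))"
      using insert.prems(3) s by (intro sum.cong) auto
    also have "\<dots> = (\<Sum>a\<in>t. smult V (?s (w a)) (f a))"
      using insert.hyps by simp
    finally have "smult V (?s \<mu>) u = (\<Sum>a\<in>t. smult V (?s (w a)) (f a))" .
    moreover have "smult V (?s \<mu>) u \<in> weight_space l V \<mu>"
      using insert.prems(1) by (rule subspace_scale[OF subspace_weight_space])
    ultimately have "smult V (?s \<mu>) u = 0"
      using insert.prems(3) subspace_scale[OF subspace_weight_space]
      by (intro insert.IH[of _ "\<lambda>a. smult V (?s (w a)) (f a)"]) auto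
    thus "u = 0" using c by (auto simp: scale_eq_0_iff)
  qed
  have "\<not> ((\<forall>i\<le>l. coroot i (w b) = coroot i \<mu>) \<and> scaling (w b) = scaling \<mu>)"
    using insert.prems(3)[of b] assms(5) weight_eqI[of "w b" l \<mu>] by blast
  then consider i where "i \<le> l" "coroot i (w b) \<noteq> coroot i \<mu>" | "scaling (w b) \<noteq> scaling \<mu>"
    by blast
  thus ?case
  proof cases
    case 1
    show ?thesis
      by (rule separated[of "H V i" "coroot i"]) (use 1 module_hom_H in \<open>auto simp: weight_space_def\<close>)
  next
    case 2
    show ?thesis
      by (rule separated[of "D V" scaling]) (use 2 module_hom_D in \<open>auto simp: weight_space_def\<close>)
  qed
qed simp

text \<open>Turns a spanning set of weight vectors into a bound on the weights: for
  \<open>\<mu>\<close> outside \<open>L\<close>, \<open>v\<close> would be a sum of vectors of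
  weights other than \<open>\<mu>\<close>, hence 0 by independence.\<close>

lemma span_weight_spaces:
  assumes "v \<in> span (\<Union>\<nu>\<in>L. weight_space l V \<nu>)" "L \<subseteq> weight_lattice l"
    and "v \<in> weight_space l V \<mu>" "v \<noteq> 0" "\<mu> \<in> weight_lattice l"
  shows "\<mu> \<in> L"
proof (rule ccontr)
  assume "\<mu> \<notin> L"
  obtain t r where t: "finite t" "t \<subseteq> (\<Union>\<nu>\<in>L. weight_space l V \<nu>)" "v = (\<Sum>a\<in>t. smult V (r a) a)"
    using assms(1) unfolding span_explicit by blast
  have "\<forall>a\<in>t. \<exists>\<nu>. \<nu> \<in> L \<and> a \<in> weight_space l V \<nu>" using t(2) by blast
  then obtain w where w: "\<forall>a\<in>t. w a \<in> L \<and> a \<in> weight_space l V (w a)" by metis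
  have "v = 0"
    by (rule weight_space_sum_eq_0[OF t(1) assms(3) t(3) _ assms(5), of w])
      (use w assms(2) \<open>\<mu> \<notin> L\<close> subspace_scale[OF subspace_weight_space] in auto)
  thus False using assms(4) by contradiction
qed

text \<open>The monomials in the \<open>f_i\<close> applied to \<open>v\<close>; they span
  \<open>U(n^-) v\<close>.\<close>

inductive_set descendants :: "'v \<Rightarrow> 'v set" for v where
  base: "v \<in> descendants v"
| step: "w \<in> descendants v \<Longrightarrow> i \<le> l \<Longrightarrow> F V i w \<in> descendants v"

lemma descendants_weight:
  assumes "v \<in> weight_space l V \<Lambda>" "w \<in> descendants v"
  shows "\<exists>x. (\<forall>i. 0 \<le> x i) \<and> w \<in> weight_space l V (\<Lambda> - root_comb l x)"
  using assms(2)
proof induction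
  case base
  show ?case using assms(1) by (intro exI[of _ "\<lambda>i. 0"]) (simp add: root_comb_0)
next
  case (step w i)
  then obtain x where x: "\<forall>i. 0 \<le> x i" "w \<in> weight_space l V (\<Lambda> - root_comb l x)" by blast
  have "root_comb l (\<lambda>j. x j + of_bool (j = i)) = root_comb l x + simple_root l i"
    using step.hyps by (simp only: root_comb_add root_comb_single)
  thus ?case using x F_weight_space[OF step.hyps(2) x(2)]
    by (intro exI[of _ "\<lambda>j. x j + of_bool (j = i)"]) (simp add: diff_diff_add)
qed

text \<open>Weight vectors are scaled by \<open>H\<close> and \<open>D\<close>, and \<open>F\<close>
  preserves the monomials. An \<open>E V i\<close> is moved to the right through the monomial until
  it kills \<open>v\<close>, leaving terms with \<open>H V i\<close> on the way.\<close>

lemma submodule_span_descendants: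
  assumes v: "v \<in> weight_space l V \<Lambda>" and Ev: "\<And>i. i \<le> l \<Longrightarrow> E V i v = 0"
  shows "submodule l V (span (descendants v))"
proof -
  let ?W = "span (descendants v)"
  have stable: "X w \<in> ?W"
    if "module_hom (smult V) (smult V) X" "\<And>w. w \<in> descendants v \<Longrightarrow> X w \<in> ?W" "w \<in> ?W" for X w
    using that(3)
  proof (induction rule: span_induct_alt)
    case base
    show ?case using module_hom.zero[OF that(1)] by (simp add: span_zero)
  next
    case (step c x y)
    thus ?case using that(2) by (auto simp: module_hom.add[OF that(1)] module_hom.scale[OF that(1)]
        intro: span_add span_scale)
  qed
  have gen_H: "H V i w \<in> ?W" if "w \<in> descendants v" "i \<le> l" for i w
    using descendants_weight[OF v that(1)] that span_scale[OF span_base[OF that(1)]]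
    by (auto simp: weight_space_def)
  have gen_D: "D V w \<in> ?W" if "w \<in> descendants v" for w
    using descendants_weight[OF v that(1)] that span_scale[OF span_base[OF that(1)]]
    by (auto simp: weight_space_def)
  have gen_F: "F V i w \<in> ?W" if "w \<in> descendants v" "i \<le> l" for i w
    using that by (intro span_base descendants.step)
  have gen_E: "E V i w \<in> ?W" if "w \<in> descendants v" "i \<le> l" for i w
    using that(1)
  proof induction
    case base
    show ?case using Ev that(2) by (simp add: span_zero)
  next
    case (step w j)
    \<comment> \<open>The induction hypothesis places \<open>E V i w\<close> only in the span, so
      stability of the whole span under \<open>F V j\<close> is required here.\<close>
    have "F V j (E V i w) \<in> ?W"
      by (rule stable[OF module_hom_F gen_F step.IH]) (use step in auto)
    thus ?case using step gen_H[OF step.hyps(1) that(2)] that(2)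
      by (auto simp: E_F intro: span_add)
  qed
  show ?thesis unfolding submodule_def
    using stable[OF module_hom_E gen_E] stable[OF module_hom_F gen_F]
      stable[OF module_hom_H gen_H] stable[OF module_hom_D gen_D] subspace_span
    by blast
qed

text \<open>The \<open>sl_2\<close> computation upwards from a vector killed by \<open>f_i\<close>:
  \<open>E^j v\<close> has \<open>h_i\<close>-eigenvalue \<open>coroot i \<mu> + 2 j\<close>, and
  moving \<open>F\<close> past the powers of \<open>E\<close> collects minus the sum of these for
  \<open>j \<le> n\<close>.\<close>

lemma F_E_power:
  assumes i: "i \<le> l" and v: "v \<in> weight_space l V \<mu>" and Fv: "F V i v = 0"
  shows "F V i ((E V i ^^ Suc n) v) =
     smult V (- of_int (int (Suc n) * (coroot i \<mu> + int n))) ((E V i ^^ n) v)"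
proof -
  have aii: "acoef l i i = 2" by (simp add: acoef_def)
  have H: "H V i ((E V i ^^ n) v) = smult V (of_int (coroot i \<mu> + 2 * int n)) ((E V i ^^ n) v)" for n
  proof (induction n)
    case 0
    show ?case using v i by (simp add: weight_space_def)
  next
    case (Suc n)
    show ?case
      by (simp add: H_E i coroot_simple_root aii Suc.IH module_hom.scale[OF module_hom_E]
          scale_left_distrib[symmetric])
  qed
  have FE: "F V i (E V i w) = E V i (F V i w) - H V i w" for w
    using E_F[OF i i, of w] by simp
  show ?thesis
  proof (induction n)
    case 0
    show ?case using H[of 0] Fv i by (simp add: FE module_hom.zero[OF module_hom_E])
  next
    case (Suc n)
    have "F V i ((E V i ^^ Suc (Suc n)) v) = E V i (F V i ((E V i ^^ Suc n) v)) - H V i ((E V i ^^ Suc n) v)"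
      using FE by simp
    also have "\<dots> = smult V (- of_int (int (Suc n) * (coroot i \<mu> + int n))) ((E V i ^^ Suc n) v)
        - smult V (of_int (coroot i \<mu> + 2 * int (Suc n))) ((E V i ^^ Suc n) v)"
      unfolding H Suc.IH by (simp only: module_hom.scale[OF module_hom_E[OF i]] funpow.simps o_apply)
    also have "\<dots> = smult V (- of_int (int (Suc (Suc n)) * (coroot i \<mu> + int (Suc n)))) ((E V i ^^ Suc n) v)"
      by (simp only: scale_left_diff_distrib[symmetric]) (simp add: algebra_simps)
    finally show ?case .
  qed
qed

text \<open>If \<open>f_i\<close> killed a vector of positive \<open>h_i\<close>-weight, the
  coefficients in \<open>F_E_power\<close> would never vanish, so no power of \<open>e_i\<close>
  could kill it, against local nilpotence.\<close>

lemma weights_diff_simple_root: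
  assumes "integrable l V" "i \<le> l" "\<mu> \<in> weights l V" "0 < coroot i \<mu>"
  shows "\<mu> - simple_root l i \<in> weights l V"
proof -
  obtain v where v: "\<mu> \<in> weight_lattice l" "v \<in> weight_space l V \<mu>" "v \<noteq> 0"
    using assms(3) by (auto simp: weights_def)
  have "F V i v \<noteq> 0"
  proof
    assume Fv: "F V i v = 0"
    \<comment> \<open>By minimality \<open>E^(N-1) v\<close> is nonzero, while \<open>F\<close> maps
      \<open>E^N v = 0\<close> to a nonzero multiple of it; \<open>N\<close> is positive because
      \<open>v \<noteq> 0\<close>.\<close>
    define N where "N = (LEAST n. (E V i ^^ n) v = 0)"
    have ex: "\<exists>n. (E V i ^^ n) v = 0" using assms(1,2) by (auto simp: integrable_def)
    have N: "(E V i ^^ N) v = 0" unfolding N_def using ex by (rule LeastI_ex)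
    then obtain n where n: "N = Suc n" using v(3) by (cases N) auto
    have "n < N" by (simp add: n)
    hence "(E V i ^^ n) v \<noteq> 0" unfolding N_def by (rule not_less_Least)
    moreover define c where "c = int (Suc n) * (coroot i \<mu> + int n)"
    have "0 < c" unfolding c_def using assms(4) by (intro mult_pos_pos) auto
    hence "- of_int c \<noteq> (0 :: complex)" by simp
    moreover have "F V i ((E V i ^^ Suc n) v) = smult V (- of_int c) ((E V i ^^ n) v)"
      unfolding c_def by (rule F_E_power[OF assms(2) v(2) Fv])
    ultimately have "F V i ((E V i ^^ N) v) \<noteq> 0"
      unfolding n using scale_eq_0_iff by metis
    thus False using N module_hom.zero[OF module_hom_F[OF assms(2)]] by simp
  qed
  thus ?thesis using v F_weight_space[OF assms(2) v(2)]
    by (auto simp: weights_def intro: weight_lattice_diff simple_root_in_weight_lattice)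
qed

end

section \<open>Which elements of the weight lattice are weights of
  \<open>V(\<Lambda>)\<close>\<close>

locale integrable_hw_rep = affine_rep l V for l and V :: "'v::ab_group_add chevalley" +
  fixes \<Lambda> :: weight and k :: nat
  assumes l: "1 \<le> l" and k: "1 \<le> k" and \<Lambda>: "\<Lambda> \<in> P_cl l k"
    and hw: "integrable_highest_weight_module l V \<Lambda>"
begin

lemma highest_weight_props: "\<Lambda> \<in> weight_lattice l" "level l \<Lambda> = int k" "scaling \<Lambda> = 0"
  using \<Lambda> by (auto simp: P_cl_iff dominant_def)

lemma diff_root_comb_in_weight_lattice: "\<Lambda> - root_comb l x \<in> weight_lattice l"
  by (intro weight_lattice_diff highest_weight_props root_comb_in_weight_lattice)

lemma highest_weight_in_weights: "\<Lambda> \<in> weights l V"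
  using hw highest_weight_props
  by (auto simp: integrable_highest_weight_module_def highest_weight_module_def weights_def)

text \<open>The span of the descendants is a submodule containing the generator, hence all of
  \<open>V\<close>, and descendants have weights of the stated form.\<close>

lemma weights_below:
  assumes "\<mu> \<in> weights l V"
  shows "\<exists>x. (\<forall>i. 0 \<le> x i) \<and> \<mu> = \<Lambda> - root_comb l x"
proof -
  let ?L = "{\<Lambda> - root_comb l x | x. \<forall>i. 0 \<le> x i}"
  obtain v where v: "v \<in> weight_space l V \<Lambda>" "\<And>i. i \<le> l \<Longrightarrow> E V i v = 0"
      "\<And>W. submodule l V W \<Longrightarrow> v \<in> W \<Longrightarrow> W = UNIV"
    using hw by (auto simp: integrable_highest_weight_module_def highest_weight_module_def)
  have "span (descendants v) = UNIV"
    using submodule_span_descendants[OF v(1,2)] v(3) span_base[OF descendants.base] by blast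
  moreover have "descendants v \<subseteq> (\<Union>\<nu>\<in>?L. weight_space l V \<nu>)"
    using descendants_weight[OF v(1)] by blast
  hence "span (descendants v) \<subseteq> span (\<Union>\<nu>\<in>?L. weight_space l V \<nu>)"
    by (rule span_mono)
  ultimately have sp: "span (\<Union>\<nu>\<in>?L. weight_space l V \<nu>) = UNIV" by blast
  obtain u where "u \<in> weight_space l V \<mu>" "u \<noteq> 0" "\<mu> \<in> weight_lattice l"
    using assms by (auto simp: weights_def)
  hence "\<mu> \<in> ?L"
    using diff_root_comb_in_weight_lattice sp by (intro span_weight_spaces[of u ?L]) auto
  thus ?thesis by blast
qed

text \<open>
  Choose a weight \<open>\<Lambda> - root_comb l m\<close> with \<open>0 \<le> m \<le> x\<close> as low as possible.  By the
  \<open>sl\<^sub>2\<close>-step, \<open>A (x - m) \<le> 0\<close> at each \<open>i\<close> with \<open>m i < x i\<close>, and also where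
  \<open>m i = x i\<close>, off-diagonal entries of \<open>A\<close> being nonpositive.  As the columns of \<open>A\<close> sum
  to zero, \<open>x - m\<close> lies in the kernel, so it is constant; were it positive, the level of the
  dominant weight \<open>\<Lambda> - root_comb l x\<close> would be nonpositive.
\<close>

lemma dominant_below_is_weight:
  assumes x: "\<And>i. i \<le> l \<Longrightarrow> 0 \<le> x i" and dom: "\<Lambda> - root_comb l x \<in> dominant l"
  shows "\<Lambda> - root_comb l x \<in> weights l V"
proof -
  define Q where "Q m \<longleftrightarrow> (\<forall>i\<le>l. 0 \<le> m i \<and> m i \<le> x i) \<and> \<Lambda> - root_comb l m \<in> weights l V"
    for m :: "nat \<Rightarrow> int"
  have "Q (\<lambda>i. 0)" using highest_weight_in_weights x by (simp add: Q_def root_comb_0)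
  then obtain m where m: "Q m"
    and least: "\<And>m'. Q m' \<Longrightarrow> nat (\<Sum>i\<le>l. x i - m i) \<le> nat (\<Sum>i\<le>l. x i - m' i)"
    using ex_has_least_nat[of Q "\<lambda>i. 0" "\<lambda>m. nat (\<Sum>i\<le>l. x i - m i)"] by blast
  define y where "y i = x i - m i" for i
  have y0: "0 \<le> y i" if "i \<le> l" for i using m that by (simp add: Q_def y_def)
  have cr: "coroot i (root_comb l y) = coroot i (\<Lambda> - root_comb l m) - coroot i (\<Lambda> - root_comb l x)" for i
    unfolding y_def root_comb_diff by (simp add: coroot_diff)
  have stuck: "coroot i (\<Lambda> - root_comb l m) \<le> 0" if i: "i \<le> l" "0 < y i" for i
  proof (rule ccontr)
    let ?m = "\<lambda>j. m j + of_bool (j = i)"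
    assume "\<not> coroot i (\<Lambda> - root_comb l m) \<le> 0"
    moreover have "integrable l V" using hw by (simp add: integrable_highest_weight_module_def)
    ultimately have "\<Lambda> - root_comb l m - simple_root l i \<in> weights l V"
      using m i by (intro weights_diff_simple_root) (auto simp: Q_def)
    moreover have "root_comb l ?m = root_comb l m + simple_root l i"
      using i by (simp only: root_comb_add root_comb_single)
    ultimately have "Q ?m" using m i by (auto simp: Q_def diff_diff_add y_def)
    moreover have "(\<Sum>j\<le>l. x j - ?m j) = (\<Sum>j\<le>l. y j - (if j = i then 1 else 0))"
      by (intro sum.cong) (auto simp: y_def)
    hence "(\<Sum>j\<le>l. x j - ?m j) = (\<Sum>j\<le>l. y j) - 1" using i by (simp add: sum_subtractf)
    \<comment> \<open>Positivity matters because \<open>nat\<close> truncates at 0: without it the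
      measure would not strictly drop.\<close>
    moreover have "0 < (\<Sum>j\<le>l. y j)" using i y0 by (intro sum_pos2[of _ i]) auto
    ultimately show False using least[of ?m] by (simp add: y_def)
  qed
  have dom': "0 \<le> coroot i (\<Lambda> - root_comb l x)" if "i \<le> l" for i
    using dom that by (simp add: dominant_def)
  have "coroot i (root_comb l y) \<le> 0" if i: "i \<le> l" for i
  proof (cases "y i = 0")
    case True
    have "0 \<le> y (if i = l then 0 else i + 1)" "0 \<le> y (if i = 0 then l else i - 1)"
      using i by (auto intro!: y0)
    thus ?thesis using True unfolding coroot_root_comb[OF l i] by simp
  next
    case False
    thus ?thesis using stuck[OF i] y0[OF i] dom'[OF i] unfolding cr by simp
  qed
  moreover have "(\<Sum>i\<le>l. coroot i (root_comb l y)) = 0"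
    using level_root_comb[OF l, of y] by (simp add: level_def)
  ultimately have ker: "coroot i (root_comb l y) = 0" if "i \<le> l" for i
    using that sum_nonneg_eq_0_iff[of "{..l}" "\<lambda>i. - coroot i (root_comb l y)"]
    by (auto simp: sum_negf)
  have const: "y i = y 0" if "i \<le> l" for i using cartan_kernel[OF l ker that] .
  have "y 0 = 0"
  proof (rule ccontr)
    assume "y 0 \<noteq> 0"
    hence "0 < y i" if "i \<le> l" for i using const[OF that] y0[of 0] by simp
    \<comment> \<open>Since \<open>y\<close> is in the kernel, the weights at \<open>m\<close> and
      at \<open>x\<close> have equal coroots, so \<open>stuck\<close> carries over to the
      latter.\<close>
    hence "coroot i (\<Lambda> - root_comb l x) \<le> 0" if "i \<le> l" for i
      using stuck[OF that] ker[OF that] that unfolding cr by simp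
    hence "level l (\<Lambda> - root_comb l x) \<le> 0" unfolding level_def by (intro sum_nonpos) auto
    thus False using k by (simp add: level_diff level_root_comb[OF l] highest_weight_props)
  qed
  hence "root_comb l x = root_comb l m" using const by (intro root_comb_cong) (simp add: y_def)
  thus ?thesis using m by (simp add: Q_def)
qed

section \<open>The inverse of \<open>\<phi>\<close>\<close>

text \<open>Passes from matrices to \<open>root_comb\<close>; for nonnegative entries, minimum 0
  means that some entry is 0.\<close>

lemma min_solution_iff:
  "min_solution l \<Lambda> \<Lambda>' X \<longleftrightarrow> dim_vec X = l + 1 \<and> (\<forall>i\<le>l. 0 \<le> X $ i) \<and> (\<exists>i\<le>l. X $ i = 0) \<and>
     (\<forall>i\<le>l. coroot i (root_comb l (\<lambda>i. X $ i)) = coroot i (\<Lambda> - \<Lambda>'))"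
proof -
  have m: "Min ((\<lambda>i. X $ i) ` {..l}) = 0 \<longleftrightarrow> (\<exists>i\<le>l. X $ i = 0)" if "\<forall>i\<le>l. 0 \<le> X $ i"
    using that by (subst Min_eq_iff) (auto intro: rev_image_eqI)
  have c: "cartan l *\<^sub>v X = Y_vec l \<Lambda> \<Lambda>' \<longleftrightarrow>
      (\<forall>i\<le>l. coroot i (root_comb l (\<lambda>i. X $ i)) = coroot i (\<Lambda> - \<Lambda>'))" if "dim_vec X = l + 1"
  proof -
    have "(cartan l *\<^sub>v X) $ i = coroot i (root_comb l (\<lambda>i. X $ i))" if "i \<le> l" for i
      using that \<open>dim_vec X = l + 1\<close>
      by (simp add: cartan_def scalar_prod_def coroot_root_comb_sum atLeast0LessThan
          lessThan_Suc_atMost)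
    thus ?thesis
      by (auto simp: vec_eq_iff Y_vec_def cartan_def less_Suc_eq_le)
  qed
  show ?thesis unfolding min_solution_def carrier_vec_def mem_Collect_eq using m c by blast
qed

text \<open>Two solutions differ by a constant; at a zero of \<open>X\<close> it is at most 0, at a
  zero of \<open>Y\<close> at least 0.\<close>

lemma min_solution_unique:
  assumes "min_solution l \<Lambda> \<Lambda>' X" "min_solution l \<Lambda> \<Lambda>' Y"
  shows "X = Y"
proof -
  note X = assms(1)[unfolded min_solution_iff] and Y = assms(2)[unfolded min_solution_iff]
  have const: "X $ i - Y $ i = X $ 0 - Y $ 0" if "i \<le> l" for i
    by (rule cartan_kernel[OF l _ that]) (use X Y in \<open>simp add: root_comb_diff coroot_diff\<close>)
  obtain i j where ij: "i \<le> l" "X $ i = 0" "j \<le> l" "Y $ j = 0" using X Y by blast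
  have "X $ 0 = Y $ 0"
    using const[OF ij(1)] const[OF ij(3)] X[THEN conjunct2, THEN conjunct1, rule_format, OF ij(3)]
      Y[THEN conjunct2, THEN conjunct1, rule_format, OF ij(1)] ij by simp
  hence "X $ i = Y $ i" if "i \<le> l" for i using const[OF that] by simp
  thus ?thesis using X Y by (intro eq_vecI) auto
qed

text \<open>Equal levels and the sieving congruence are the solvability conditions of
  \<open>ex_root_comb\<close>; subtracting the minimum normalises the solution.\<close>

lemma ex_min_solution:
  assumes "\<Lambda>' \<in> sieve_class l k \<Lambda>"
  shows "\<exists>X. min_solution l \<Lambda> \<Lambda>' X"
proof -
  have \<Lambda>': "\<Lambda>' \<in> P_cl l k" "[ev l \<Lambda>' = ev l \<Lambda>] (mod int (l + 1))"
    using assms by (auto simp: sieve_class_def)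
  have lev: "level l (\<Lambda> - \<Lambda>') = 0"
    using \<Lambda>' highest_weight_props by (simp add: level_diff P_cl_iff)
  have "ev l (\<Lambda> - \<Lambda>') = ev l \<Lambda> - ev l \<Lambda>'"
    by (simp add: ev_def coroot_diff right_diff_distrib sum_subtractf)
  hence "int (l + 1) dvd ev l (\<Lambda> - \<Lambda>')"
    using cong_sym[OF \<Lambda>'(2)] by (simp add: cong_iff_dvd_diff)
  then obtain x where x: "\<forall>i\<le>l. coroot i (root_comb l x) = coroot i (\<Lambda> - \<Lambda>')"
    using ex_root_comb[OF l lev] by blast
  define c where "c = Min (x ` {..l})"
  have c: "c \<in> x ` {..l}" "\<And>i. i \<le> l \<Longrightarrow> c \<le> x i" unfolding c_def by (auto intro!: Min_in)
  define X where "X = vec (l + 1) (\<lambda>i. x i - c)"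
  \<comment> \<open>The shift by \<open>c\<close> is invisible because constant vectors lie in the
    kernel.\<close>
  have "coroot i (root_comb l (\<lambda>i. X $ i)) = coroot i (root_comb l x)" if "i \<le> l" for i
    using that l by (simp add: X_def coroot_root_comb)
  hence "min_solution l \<Lambda> \<Lambda>' X"
    unfolding min_solution_iff using x c by (auto simp: X_def less_Suc_eq_le)
  thus ?thesis by blast
qed

lemma min_solution_dom_max_weight:
  assumes "\<Lambda>' \<in> sieve_class l k \<Lambda>" "min_solution l \<Lambda> \<Lambda>' X"
  defines "\<mu> \<equiv> \<Lambda> - root_comb l (\<lambda>i. X $ i)"
  shows "\<mu> \<in> dom_max_weights l V" "phi l k \<mu> = \<Lambda>'"
proof -
  note X = assms(2)[unfolded min_solution_iff]
  have \<Lambda>': "\<Lambda>' \<in> dominant l" "scaling \<Lambda>' = 0"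
    using assms(1) by (auto simp: sieve_class_def P_cl_iff)
  have lat: "\<mu> \<in> weight_lattice l" unfolding \<mu>_def by (rule diff_root_comb_in_weight_lattice)
  have cr: "coroot i \<mu> = coroot i \<Lambda>'" if "i \<le> l" for i
    using X that by (simp add: \<mu>_def coroot_diff)
  have dom: "\<mu> \<in> dominant l" using lat cr \<Lambda>' by (simp add: dominant_def)
  have "\<mu> \<in> weights l V"
    using dominant_below_is_weight[of "\<lambda>i. X $ i"] X dom unfolding \<mu>_def by blast
  \<comment> \<open>Adding \<open>\<delta>\<close> replaces \<open>X\<close> by
    \<open>X - 1\<close>, which is negative at a zero of \<open>X\<close>; as coefficients are
    unique, this contradicts \<open>weights_below\<close>.\<close>
  moreover have "\<mu> + null_root \<notin> weights l V"
  proof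
    assume "\<mu> + null_root \<in> weights l V"
    then obtain y where y: "\<forall>i. 0 \<le> y i" "\<mu> + null_root = \<Lambda> - root_comb l y"
      using weights_below by blast
    have "root_comb l (\<lambda>i. X $ i - 1) = root_comb l y"
      using y(2) unfolding root_comb_diff root_comb_1[OF l] \<mu>_def by (simp add: algebra_simps)
    hence *: "X $ i - 1 = y i" if "i \<le> l" for i using root_comb_inject[OF l _ that] by blast
    obtain i where "i \<le> l" "X $ i = 0" using X by blast
    thus False using *[of i] y(1)[rule_format, of i] by simp
  qed
  ultimately show "\<mu> \<in> dom_max_weights l V"
    using dom by (simp add: dom_max_weights_def max_weights_def)
  have "level l \<mu> = int k" by (simp add: \<mu>_def level_diff level_root_comb[OF l] highest_weight_props)
  hence phi: "phi l k \<mu> = \<mu> - frag_cmul (scaling \<mu>) null_root" by (rule phi_eq[OF lat])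
  show "phi l k \<mu> = \<Lambda>'"
  proof (rule weight_eqI[of _ l])
    show "phi l k \<mu> \<in> weight_lattice l" unfolding phi
      using lookup_eq_0_outside_basis[OF lat]
      by (auto intro!: weight_latticeI simp: lookup_minus null_root_def basis_def)
    show "\<Lambda>' \<in> weight_lattice l" using \<Lambda>' by (simp add: dominant_def)
    show "scaling (phi l k \<mu>) = scaling \<Lambda>'"
      unfolding phi \<Lambda>'(2) by (simp add: scaling_def lookup_minus null_root_def)
    show "coroot i (phi l k \<mu>) = coroot i \<Lambda>'" if "i \<le> l" for i
      unfolding phi cr[OF that, symmetric] by (simp add: coroot_def lookup_minus null_root_def)
  qed
qed

lemma dom_max_weight_min_solution:
  assumes "\<mu> \<in> dom_max_weights l V"
  shows "phi l k \<mu> \<in> sieve_class l k \<Lambda>"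
    and "\<exists>X. min_solution l \<Lambda> (phi l k \<mu>) X \<and> \<mu> = \<Lambda> - root_comb l (\<lambda>i. X $ i)"
proof -
  have \<mu>: "\<mu> \<in> weights l V" "\<mu> + null_root \<notin> weights l V" "\<mu> \<in> dominant l"
    using assms by (auto simp: dom_max_weights_def max_weights_def)
  obtain x where x: "\<forall>i. 0 \<le> x i" "\<mu> = \<Lambda> - root_comb l x" using weights_below[OF \<mu>(1)] by blast
  have lat: "\<mu> \<in> weight_lattice l" using \<mu>(3) by (simp add: dominant_def)
  have lev: "level l \<mu> = int k" by (simp add: x(2) level_diff level_root_comb[OF l] highest_weight_props)
  have phi: "phi l k \<mu> = \<mu> - frag_cmul (scaling \<mu>) null_root" by (rule phi_eq[OF lat lev])
  have cr: "coroot i (phi l k \<mu>) = coroot i \<mu>" for i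
    unfolding phi by (simp add: coroot_def lookup_minus null_root_def)
  have "phi l k \<mu> \<in> weight_lattice l" unfolding phi
      using lookup_eq_0_outside_basis[OF lat]
      by (auto intro!: weight_latticeI simp: lookup_minus null_root_def basis_def)
  moreover have "scaling (phi l k \<mu>) = 0"
    unfolding phi by (simp add: scaling_def lookup_minus null_root_def)
  moreover have "level l (phi l k \<mu>) = int k" using lev by (simp add: level_def cr)
  ultimately have "phi l k \<mu> \<in> P_cl l k"
    using \<mu>(3) by (simp add: P_cl_iff dominant_def cr)
  moreover have "ev l (phi l k \<mu>) - ev l \<Lambda> = - ev l (root_comb l x)"
    unfolding ev_def cr unfolding x(2) by (simp add: coroot_diff right_diff_distrib sum_subtractf)
  hence "[ev l (phi l k \<mu>) = ev l \<Lambda>] (mod int (l + 1))"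
    unfolding cong_iff_dvd_diff ev_root_comb[OF l] by simp
  ultimately show "phi l k \<mu> \<in> sieve_class l k \<Lambda>" by (simp add: sieve_class_def)
  define X where "X = vec (l + 1) x"
  have Xx: "root_comb l (\<lambda>i. X $ i) = root_comb l x" by (rule root_comb_cong) (simp add: X_def)
  \<comment> \<open>If all \<open>x i\<close> were positive, \<open>\<mu> + \<delta>\<close> would
    have nonnegative coefficients \<open>x i - 1\<close>. It is dominant since coroots vanish on
    \<open>\<delta>\<close>, hence a weight, against maximality.\<close>
  have "\<exists>i\<le>l. x i = 0"
  proof (rule ccontr)
    assume "\<not> (\<exists>i\<le>l. x i = 0)"
    hence pos: "0 \<le> x i - 1" if "i \<le> l" for i
    proof -
      have "0 \<le> x i" "x i \<noteq> 0" using x(1) \<open>\<not> (\<exists>i\<le>l. x i = 0)\<close> that by auto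
      thus ?thesis by simp
    qed
    have eq: "\<Lambda> - root_comb l (\<lambda>i. x i - 1) = \<mu> + null_root"
      unfolding root_comb_diff root_comb_1[OF l] x(2) by (simp add: algebra_simps)
    have "\<mu> + null_root \<in> dominant l"
      using \<mu>(3) by (auto simp: dominant_def coroot_add coroot_null_root weight_lattice_add
          null_root_in_weight_lattice)
    hence "\<mu> + null_root \<in> weights l V"
      using dominant_below_is_weight[of "\<lambda>i. x i - 1"] pos unfolding eq by blast
    thus False using \<mu>(2) by contradiction
  qed
  moreover have "coroot i (\<Lambda> - phi l k \<mu>) = coroot i (root_comb l x)" for i
    unfolding coroot_diff cr unfolding x(2) by (simp add: coroot_diff)
  ultimately have "min_solution l \<Lambda> (phi l k \<mu>) X"
    unfolding min_solution_iff Xx using x(1) by (auto simp: X_def)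
  thus "\<exists>X. min_solution l \<Lambda> (phi l k \<mu>) X \<and> \<mu> = \<Lambda> - root_comb l (\<lambda>i. X $ i)"
    using Xx x(2) by auto
qed

text \<open>Uniqueness of the minimal solution recovers \<open>\<mu>\<close> from its image, giving
  injectivity; existence gives surjectivity.\<close>

lemma bij_betw_phi: "bij_betw (phi l k) (dom_max_weights l V) (sieve_class l k \<Lambda>)"
  unfolding bij_betw_def
proof
  show "inj_on (phi l k) (dom_max_weights l V)"
  proof (rule inj_onI)
    fix \<mu> \<nu>
    assume *: "\<mu> \<in> dom_max_weights l V" "\<nu> \<in> dom_max_weights l V" "phi l k \<mu> = phi l k \<nu>"
    obtain X Y where "min_solution l \<Lambda> (phi l k \<mu>) X" "\<mu> = \<Lambda> - root_comb l (\<lambda>i. X $ i)"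
      "min_solution l \<Lambda> (phi l k \<nu>) Y" "\<nu> = \<Lambda> - root_comb l (\<lambda>i. Y $ i)"
      using dom_max_weight_min_solution(2) *(1,2) by metis
    thus "\<mu> = \<nu>" using min_solution_unique *(3) by metis
  qed
  show "phi l k ` dom_max_weights l V = sieve_class l k \<Lambda>"
  proof
    show "phi l k ` dom_max_weights l V \<subseteq> sieve_class l k \<Lambda>"
      using dom_max_weight_min_solution(1) by blast
    show "sieve_class l k \<Lambda> \<subseteq> phi l k ` dom_max_weights l V"
    proof
      fix \<Lambda>' assume \<Lambda>': "\<Lambda>' \<in> sieve_class l k \<Lambda>"
      obtain X where X: "min_solution l \<Lambda> \<Lambda>' X" using ex_min_solution[OF \<Lambda>'] by blast
      show "\<Lambda>' \<in> phi l k ` dom_max_weights l V"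
        by (rule rev_image_eqI[OF min_solution_dom_max_weight(1)[OF \<Lambda>' X]])
          (rule min_solution_dom_max_weight(2)[OF \<Lambda>' X, symmetric])
    qed
  qed
qed

end

theorem theorem3p4:
  fixes l k :: nat and \<Lambda> :: weight and V :: "'v::ab_group_add chevalley"
  assumes "1 \<le> l" and "1 \<le> k" and "\<Lambda> \<in> P_cl l k"
    and "integrable_highest_weight_module l V \<Lambda>"
  shows "bij_betw (phi l k) (dom_max_weights l V) (sieve_class l k \<Lambda>) \<and>
    (\<forall>\<Lambda>' \<in> sieve_class l k \<Lambda>.
       (\<exists>!X. min_solution l \<Lambda> \<Lambda>' X) \<and>
       (\<forall>X. min_solution l \<Lambda> \<Lambda>' X \<longrightarrow>
          inv_into (dom_max_weights l V) (phi l k) \<Lambda>' =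
            \<Lambda> - (\<Sum>i\<le>l. frag_cmul (X $ i) (simple_root l i))))"
proof -
  interpret integrable_hw_rep l V \<Lambda> k
    using assms by unfold_locales
      (auto simp: integrable_highest_weight_module_def highest_weight_module_def)
  \<comment> \<open>By injectivity it suffices that the proposed weight lies in the domain and is
    sent to \<open>\<Lambda>'\<close>.\<close>
  have "inv_into (dom_max_weights l V) (phi l k) \<Lambda>' =
      \<Lambda> - (\<Sum>i\<le>l. frag_cmul (X $ i) (simple_root l i))"
    if "\<Lambda>' \<in> sieve_class l k \<Lambda>" "min_solution l \<Lambda> \<Lambda>' X" for \<Lambda>' X
    using min_solution_dom_max_weight[OF that] bij_betw_imp_inj_on[OF bij_betw_phi]
    unfolding root_comb_def by (intro inv_into_f_eq) simp_all
  thus ?thesis using bij_betw_phi ex_min_solution min_solution_unique by blast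
qed

end
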